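(* Let $\boldsymbol{\theta}=(\theta_0,\theta_1,\theta_t,\theta_\infty)\in\mathbb{C}^*\times\mathbb{C}^*\times\mathbb{C}^*\times(\mathbb{C}\setminus\{1\})$ and $\Theta_i(q)=1+\frac{q-1}{2}\theta_i$ for $i\in\{0,1,t,\infty\}$. For $t\in\mathbb{C}^*$ let $\Omega_t$ be the family over the $q$-line defined in the context. Then: (1) $\Omega_t|_{q=1}=\mathrm{Oka}_t$ for all $t\in\mathbb{C}\setminus\{0,1\}$; (2) $\Omega_t|_{q=q_0}=q\widetilde{\mathrm{Oka}}_t(q_0)$ for all $(t,q_0)\in\mathbb{C}^*\times(\mathbb{C}\setminus\{0,1\})$ such that $\Theta_0(q_0)^2\ne1$, $\Theta_1(q_0)^2\ne1$, $\Theta_t(q_0)^2\neq1$, $\Theta_\infty(q_0)^2\ne q_0$ (with all $\Theta_i(q_0)\neq 0$) and $t\notin S_{q_0}$.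
   Context: $\mathbb{F}_2$ is the second Hirzebruch surface, covered by four charts $\mathbb{C}^2$ with coordinates $(u,v)$, $(u_1,v_1)=(u,\frac1v)$, $(u_2,v_2)=(\frac1u,\frac v{u^2})$, $(u_3,v_3)=(\frac1u,\frac{u^2}{v})$. In $\mathbb{F}_2$ put $\mathcal{H}=\{v_1=0\}\cup\{v_3=0\}$, $\mathcal{D}_c=\{u=c\}\cup\{u_1=c\}$ for $c\in\mathbb{C}$, and $\mathcal{D}_\infty=\{u_2=0\}\cup\{u_3=0\}$. Differential Okamoto space. For $t\in\mathbb{C}\setminus\{0,1\}$, $\mathrm{Oka}_t$ is the blow-up of $\mathbb{F}_2$ at the eight points $\beta_0^\pm:(u,v)=(0,\pm\frac{t\theta_0}{2})$, $\beta_1^\pm:(u,v)=(1,\pm\frac{(t-1)\theta_1}{2})$, $\beta_t^\pm:(u,v)=(t,\pm\frac{t(t-1)\theta_t}{2})$, $\beta_\infty^+:(u_2,v_2)=(0,\frac{\theta_\infty-2}{2})$, $\beta_\infty^-:(u_2,v_2)=(0,-\frac{\theta_\infty}{2})$, minus the union of $\mathcal{H}$ and of the strict transforms of $\mathcal{D}_0,\mathcal{D}_1,\mathcal{D}_t,\mathcal{D}_\infty$. Modified $q$-Okamoto space. Let $q\in\mathbb{C}\setminus\{0,1\}$, $\Theta_i=\Theta_i(q)\neq0$, $\overline{\Theta}_i=1/\Theta_i$, $\Theta_0^2,\Theta_1^2,\Theta_t^2\neq1$, $\Theta_\infty^2\ne q$, and $$S_q=\{\Theta_1^{\varepsilon_1}\Theta_t^{\varepsilon_t},\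 \Theta_0^{\varepsilon_0}\Theta_\infty^{\varepsilon_\infty}\mid\varepsilon_0,\varepsilon_1,\varepsilon_t,\varepsilon_\infty\in\{-1,1\}\}\cdot q^{\mathbb{Z}}.$$ For $t\in\mathbb{C}^*\setminus S_q$, $q\widetilde{\mathrm{Oka}}_t(q)$ is the blow-up of $\mathbb{F}_2$ at the eight points $\boldsymbol\beta_0^-:(u,v)=(0,\frac{t(\overline\Theta_0-1)}{q-1})$, $\boldsymbol\beta_0^+:(u,v)=(0,\frac{t(\Theta_0-1)}{q-1})$, $\boldsymbol\beta_1^-:(u,v)=(\overline\Theta_1,\frac{(\overline\Theta_1-1)(t-\overline\Theta_1)}{q-1})$, $\boldsymbol\beta_1^+:(u,v)=(\Theta_1,\frac{(\Theta_1-1)(t-\Theta_1)}{q-1})$, $\boldsymbol\beta_t^-:(u,v)=(t\Theta_t,-\frac{t(\Theta_t-1)(t\Theta_t-1)}{q-1})$, $\boldsymbol\beta_t^+:(u,v)=(t\overline\Theta_t,-\frac{t(\overline\Theta_t-1)(t\overline\Theta_t-1)}{q-1})$, $\boldsymbol\beta_\infty^-:(u_2,v_2)=(0,\frac{\overline\Theta_\infty-1}{q-1})$, $\boldsymbol\beta_\infty^+:(u_2,v_2)=(0,\frac{\Theta_\infty-q}{q(q-1)})$, minus the strict transforms of $\mathcal{H},\mathcal{D}_0,\mathcal{D}_\infty$ and of the curve $\boldsymbol{\mathcal C}_q\subset\mathbb{F}_2$, the closure of $\{(u-1)(u-t)=(1-q)v\}$. The family $\Omega_t$. For fixed $t\in\mathbb{C}^*$,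 consider the eight curves in $\mathbb{C}^*\times\mathbb{F}_2$ (first coordinate $q$, restricted to those $q$ where the expressions are defined, in particular near $q=1$) parametrized by $q\mapsto(q,\boldsymbol\beta_i^\pm(q))$, where $\boldsymbol\beta_0^-(q):(u,v)=(0,\frac{-t\theta_0/2}{\Theta_0(q)})$, $\boldsymbol\beta_0^+(q):(u,v)=(0,\frac{t\theta_0}{2})$, $\boldsymbol\beta_1^-(q):(u,v)=\left(\frac1{\Theta_1(q)},\frac{-\frac{\theta_1}{2}\left(t-\frac{1}{\Theta_1(q)}\right)}{\Theta_1(q)}\right)$, $\boldsymbol\beta_1^+(q):(u,v)=(\Theta_1(q),\frac{\theta_1(t-\Theta_1(q))}{2})$, $\boldsymbol\beta_t^-(q):(u,v)=(t\Theta_t(q),-\frac{t\theta_t}{2}(t\Theta_t(q)-1))$, $\boldsymbol\beta_t^+(q):(u,v)=\left(\frac{t}{\Theta_t(q)},\frac{t(t-\Theta_t(q))\theta_t/2}{\Theta_t(q)^2}\right)$, $\boldsymbol\beta_\infty^-(q):(u_2,v_2)=(0,\frac{-\theta_\infty/2}{\Theta_\infty(q)})$, $\boldsymbol\beta_\infty^+(q):(u_2,v_2)=(0,\frac{\theta_\infty/2-1}{q})$. Let $\boldsymbol{\mathcal{C}}\subset\mathbb{C}^*\times\mathbb{F}_2$ be the surface which is the closure of $\{(u-1)(u-t)=(1-q)v\}$ (given by $(u_1-1)(u_1-t)v_1=1-q$ and $(1-u_3)(1-tu_3)v_3=1-q$ in the charts $(u_1,v_1)$, $(u_3,v_3)$).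 Then $\Omega_t$ is the blow-up of $\mathbb{C}^*\times\mathbb{F}_2$ along the eight curves $\boldsymbol\beta_i^\pm$ minus the strict transforms of the surfaces $\mathbb{C}^*\times\mathcal{H}$, $\boldsymbol{\mathcal{C}}$, $\mathbb{C}^*\times\mathcal{D}_0$, $\mathbb{C}^*\times\mathcal{D}_\infty$. (For values of $q$ at which some of the curves intersect, one fixes an arbitrary order of blowing up; such $q$ are irrelevant to the claim.) $\Omega_t|_{q=q_0}$ denotes the fibre over $q_0$. *)

theory Defs
  imports "HOL-Analysis.Analysis"
begin

section \<open>Complex manifolds and holomorphic maps\<close>

text \<open>
  The library has no complex manifolds. An \<open>n\<close>-dimensional one is given here by an atlas: a set
  of pairs \<open>(U, \<phi>)\<close> of a chart domain \<open>U\<close> and a coordinate map \<open>\<phi>\<close>, injective on \<open>U\<close> with open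
  image in \<open>\<complex>\<^sup>n\<close>. All atlases built below are compatible ones, i.e. their coordinate changes
  are holomorphic.
\<close>

type_synonym ('a, 'n) chart = "'a set \<times> ('a \<Rightarrow> (complex, 'n) vec)"
type_synonym ('a, 'n) atlas = "('a, 'n) chart set"

definition points :: "('a, 'n::finite) atlas \<Rightarrow> 'a set" where
  "points A = (\<Union>(U, \<phi>)\<in>A. U)"

definition atlas_topology :: "('a, 'n::finite) atlas \<Rightarrow> 'a topology" where
  "atlas_topology A =
     topology_generated_by {W. \<exists>(U, \<phi>)\<in>A. \<exists>O'. open O' \<and> W = {p \<in> U. \<phi> p \<in> O'}}"

definition holomorphic_vec_on :: "(complex^'n \<Rightarrow> complex^'m) \<Rightarrow> (complex^'n) set \<Rightarrow> bool" where
  "holomorphic_vec_on f S \<longleftrightarrow>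
     (\<forall>x\<in>S. \<exists>D. (f has_derivative D) (at x) \<and> (\<forall>c w. D (c *s w) = c *s D w))"

definition holomorphic_map_on ::
  "('a, 'n::finite) atlas \<Rightarrow> ('b, 'm::finite) atlas \<Rightarrow> 'a set \<Rightarrow> ('a \<Rightarrow> 'b) \<Rightarrow> bool" where
  "holomorphic_map_on A B W f \<longleftrightarrow>
     openin (atlas_topology A) W \<and>
     (\<forall>p\<in>W. \<exists>(U, \<phi>)\<in>A. \<exists>(V, \<psi>)\<in>B. p \<in> U \<and> f p \<in> V \<and>
        (\<exists>O'. open O' \<and> \<phi> p \<in> O' \<and> O' \<subseteq> \<phi> ` (U \<inter> W) \<and>
           (\<forall>x\<in>O'. f (inv_into U \<phi> x) \<in> V) \<and>
           holomorphic_vec_on (\<lambda>x. \<psi> (f (inv_into U \<phi> x))) O'))"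

text \<open>
  A map between subsets (in the application: a closed submanifold \<open>S\<close> and an open one \<open>T\<close>) is
  holomorphic if it extends locally to a holomorphic map of the ambient manifolds.
\<close>

definition holomorphic_between ::
  "('a, 'n::finite) atlas \<Rightarrow> 'a set \<Rightarrow> ('b, 'm::finite) atlas \<Rightarrow> 'b set \<Rightarrow> ('a \<Rightarrow> 'b) \<Rightarrow> bool" where
  "holomorphic_between A S B T f \<longleftrightarrow>
     f ` S \<subseteq> T \<and>
     (\<forall>p\<in>S. \<exists>W F. p \<in> W \<and> holomorphic_map_on A B W F \<and> (\<forall>x\<in>S \<inter> W. F x = f x))"

definition biholomorphic_between ::
  "('a, 'n::finite) atlas \<Rightarrow> 'a set \<Rightarrow> ('b, 'm::finite) atlas \<Rightarrow> 'b set \<Rightarrow> ('a \<Rightarrow> 'b) \<Rightarrow> bool" where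
  "biholomorphic_between A S B T f \<longleftrightarrow>
     bij_betw f S T \<and> holomorphic_between A S B T f \<and>
     holomorphic_between B T A S (inv_into S f)"

definition remove_closed :: "('a, 'n::finite) atlas \<Rightarrow> 'a set \<Rightarrow> ('a, 'n) atlas" where
  "remove_closed A R = (\<lambda>(U, \<phi>). (U - R, \<phi>)) ` A"


section \<open>Blow-ups in codimension two\<close>

text \<open>
  A smooth centre \<open>Z\<close> of codimension two is presented by an adapted chart \<open>(U, \<phi>)\<close>, in which
  \<open>Z\<close> is cut out by the vanishing of the first two coordinates \<open>x, y\<close>. These trivialise the
  projectivised normal bundle of \<open>Z\<close>. As a set the blow-up is the complement of \<open>Z\<close>
  (points \<open>Off p\<close>) together with this bundle: \<open>Exc p (Some s)\<close> is the normal direction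
  \<open>[x : y] = [1 : s]\<close> at \<open>p \<in> Z\<close>, and \<open>Exc p None\<close> is \<open>[0 : 1]\<close>.
  Several pairwise disjoint centres are blown up at the same time.
\<close>

datatype 'a blown = Off 'a | Exc 'a "complex option"

primrec down :: "'a blown \<Rightarrow> 'a" where
  "down (Off p) = p"
| "down (Exc p l) = p"

definition centre :: "('a, 'n::{finite,numeral}) chart \<Rightarrow> 'a set" where
  "centre c = {p \<in> fst c. snd c p $ 1 = 0 \<and> snd c p $ 2 = 0}"

definition centres :: "('a, 'n::{finite,numeral}) chart set \<Rightarrow> 'a set" where
  "centres C = (\<Union>c\<in>C. centre c)"

definition set12 :: "complex \<Rightarrow> complex \<Rightarrow> (complex, 'n::{finite,numeral}) vec \<Rightarrow> (complex, 'n) vec" where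
  "set12 a b w = (\<chi> k. if k = 1 then a else if k = 2 then b else w $ k)"

text \<open>The two charts \<open>(x, y/x, \<dots>)\<close> and \<open>(x/y, y, \<dots>)\<close> near an exceptional divisor.\<close>

definition exc_chart1 ::
  "('a, 'n::{finite,numeral}) chart set \<Rightarrow> ('a, 'n) chart \<Rightarrow> ('a blown, 'n) chart" where
  "exc_chart1 C c = (case c of (U, \<phi>) \<Rightarrow>
     ({Off p | p. p \<in> U - centres C \<and> \<phi> p $ 1 \<noteq> 0} \<union> {Exc p (Some s) | p s. p \<in> centre c},
      \<lambda>z. case z of
            Off p \<Rightarrow> set12 (\<phi> p $ 1) (\<phi> p $ 2 / \<phi> p $ 1) (\<phi> p)
          | Exc p l \<Rightarrow> set12 0 (the l) (\<phi> p)))"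

definition exc_chart2 ::
  "('a, 'n::{finite,numeral}) chart set \<Rightarrow> ('a, 'n) chart \<Rightarrow> ('a blown, 'n) chart" where
  "exc_chart2 C c = (case c of (U, \<phi>) \<Rightarrow>
     ({Off p | p. p \<in> U - centres C \<and> \<phi> p $ 2 \<noteq> 0} \<union> {Exc p l | p l. p \<in> centre c \<and> l \<noteq> Some 0},
      \<lambda>z. case z of
            Off p \<Rightarrow> set12 (\<phi> p $ 1 / \<phi> p $ 2) (\<phi> p $ 2) (\<phi> p)
          | Exc p l \<Rightarrow> set12 (case l of None \<Rightarrow> 0 | Some s \<Rightarrow> 1 / s) 0 (\<phi> p)))"

definition blowup ::
  "('a, 'n::{finite,numeral}) atlas \<Rightarrow> ('a, 'n) chart set \<Rightarrow> ('a blown, 'n) atlas" where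
  "blowup A C =
     {(Off ` (U - centres C), \<phi> \<circ> down) | U \<phi>. (U, \<phi>) \<in> A} \<union>
     exc_chart1 C ` C \<union> exc_chart2 C ` C"

definition strict_transform ::
  "('a, 'n::{finite,numeral}) atlas \<Rightarrow> ('a, 'n) chart set \<Rightarrow> 'a set \<Rightarrow> 'a blown set" where
  "strict_transform A C S = atlas_topology (blowup A C) closure_of (Off ` (S - centres C))"


section \<open>The second Hirzebruch surface\<close>

text \<open>
  In \<open>(Some u, w)\<close> the second entry is the coordinate \<open>v\<close> on the ruling over \<open>u \<in> \<complex>\<close>, in
  \<open>(None, w)\<close> it is the coordinate \<open>v\<^sub>2\<close> on the ruling over \<open>u = \<infinity>\<close>; in both cases
  \<open>w = None\<close> stands for \<open>\<infinity>\<close>. The maps below send a pair of coordinates in one of the four charts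
  to the corresponding point.
\<close>

type_synonym hirz = "complex option \<times> complex option"

definition uv :: "complex \<Rightarrow> complex \<Rightarrow> hirz" where
  "uv u v = (Some u, Some v)"

definition uv1 :: "complex \<Rightarrow> complex \<Rightarrow> hirz" where
  "uv1 u v = (Some u, if v = 0 then None else Some (1 / v))"

definition uv2 :: "complex \<Rightarrow> complex \<Rightarrow> hirz" where
  "uv2 u v = (if u = 0 then (None, Some v) else (Some (1 / u), Some (v / u\<^sup>2)))"

definition uv3 :: "complex \<Rightarrow> complex \<Rightarrow> hirz" where
  "uv3 u v =
     (if u = 0 then (None, if v = 0 then None else Some (1 / v))
      else (Some (1 / u), if v = 0 then None else Some (1 / (u\<^sup>2 * v))))"

lemma hirz_coordinate_changes:
  "v \<noteq> 0 \<Longrightarrow> uv u v = uv1 u (1 / v)"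
  "u \<noteq> 0 \<Longrightarrow> uv u v = uv2 (1 / u) (v / u\<^sup>2)"
  "u \<noteq> 0 \<Longrightarrow> v \<noteq> 0 \<Longrightarrow> uv u v = uv3 (1 / u) (u\<^sup>2 / v)"
  by (simp_all add: uv_def uv1_def uv2_def uv3_def field_simps)

definition param_dom :: "(complex \<Rightarrow> complex \<Rightarrow> 'a) \<Rightarrow> 'a set" where
  "param_dom \<psi> = {\<psi> a b | a b. True}"

definition param_inv :: "(complex \<Rightarrow> complex \<Rightarrow> 'a) \<Rightarrow> 'a \<Rightarrow> complex^2" where
  "param_inv \<psi> = inv (\<lambda>x::complex^2. \<psi> (x $ 1) (x $ 2))"

definition F2 :: "(hirz, 2) atlas" where
  "F2 = (\<lambda>\<psi>. (param_dom \<psi>, param_inv \<psi>)) ` {uv, uv1, uv2, uv3}"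

definition curve_H :: "hirz set" where
  "curve_H = {uv1 u 0 | u. True} \<union> {uv3 u 0 | u. True}"

definition curve_D :: "complex \<Rightarrow> hirz set" where
  "curve_D c = {uv c v | v. True} \<union> {uv1 c v | v. True}"

definition curve_D_inf :: "hirz set" where
  "curve_D_inf = {uv2 0 v | v. True} \<union> {uv3 0 v | v. True}"

text \<open>The point with coordinates \<open>(a, b)\<close> in the chart parametrised by \<open>\<psi>\<close>, as a centre.\<close>

definition point_centre :: "(complex \<Rightarrow> complex \<Rightarrow> hirz) \<times> complex \<times> complex \<Rightarrow> (hirz, 2) chart" where
  "point_centre = (\<lambda>(\<psi>, a, b). (param_dom \<psi>, \<lambda>p. param_inv \<psi> p - vector [a, b]))"


section \<open>The two Okamoto spaces\<close>

definition oka_points ::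
  "complex \<Rightarrow> complex \<Rightarrow> complex \<Rightarrow> complex \<Rightarrow> complex \<Rightarrow>
     ((complex \<Rightarrow> complex \<Rightarrow> hirz) \<times> complex \<times> complex) list" where
  "oka_points \<theta>0 \<theta>1 \<theta>t \<theta>inf t =
    [(uv, 0, t * \<theta>0 / 2), (uv, 0, - (t * \<theta>0 / 2)),
     (uv, 1, (t - 1) * \<theta>1 / 2), (uv, 1, - ((t - 1) * \<theta>1 / 2)),
     (uv, t, t * (t - 1) * \<theta>t / 2), (uv, t, - (t * (t - 1) * \<theta>t / 2)),
     (uv2, 0, (\<theta>inf - 2) / 2), (uv2, 0, - (\<theta>inf / 2))]"

definition Oka ::
  "complex \<Rightarrow> complex \<Rightarrow> complex \<Rightarrow> complex \<Rightarrow> complex \<Rightarrow> (hirz blown, 2) atlas" where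
  "Oka \<theta>0 \<theta>1 \<theta>t \<theta>inf t =
    (let C = point_centre ` set (oka_points \<theta>0 \<theta>1 \<theta>t \<theta>inf t)
     in remove_closed (blowup F2 C)
          (down -` curve_H \<union> strict_transform F2 C (curve_D 0) \<union> strict_transform F2 C (curve_D 1) \<union>
           strict_transform F2 C (curve_D t) \<union> strict_transform F2 C curve_D_inf))"

definition qoka_points ::
  "complex \<Rightarrow> complex \<Rightarrow> complex \<Rightarrow> complex \<Rightarrow> complex \<Rightarrow> complex \<Rightarrow>
     ((complex \<Rightarrow> complex \<Rightarrow> hirz) \<times> complex \<times> complex) list" where
  "qoka_points q \<Theta>0 \<Theta>1 \<Theta>t \<Theta>inf t =
    [(uv, 0, t * (1 / \<Theta>0 - 1) / (q - 1)),
     (uv, 0, t * (\<Theta>0 - 1) / (q - 1)),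
     (uv, 1 / \<Theta>1, (1 / \<Theta>1 - 1) * (t - 1 / \<Theta>1) / (q - 1)),
     (uv, \<Theta>1, (\<Theta>1 - 1) * (t - \<Theta>1) / (q - 1)),
     (uv, t * \<Theta>t, - (t * (\<Theta>t - 1) * (t * \<Theta>t - 1) / (q - 1))),
     (uv, t * (1 / \<Theta>t), - (t * (1 / \<Theta>t - 1) * (t * (1 / \<Theta>t) - 1) / (q - 1))),
     (uv2, 0, (1 / \<Theta>inf - 1) / (q - 1)),
     (uv2, 0, (\<Theta>inf - q) / (q * (q - 1)))]"

definition curve_Cq :: "complex \<Rightarrow> complex \<Rightarrow> hirz set" where
  "curve_Cq q t = atlas_topology F2 closure_of {uv u v | u v. (u - 1) * (u - t) = (1 - q) * v}"

definition qOka ::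
  "complex \<Rightarrow> complex \<Rightarrow> complex \<Rightarrow> complex \<Rightarrow> complex \<Rightarrow> complex \<Rightarrow> (hirz blown, 2) atlas" where
  "qOka q \<Theta>0 \<Theta>1 \<Theta>t \<Theta>inf t =
    (let C = point_centre ` set (qoka_points q \<Theta>0 \<Theta>1 \<Theta>t \<Theta>inf t)
     in remove_closed (blowup F2 C)
          (strict_transform F2 C curve_H \<union> strict_transform F2 C (curve_D 0) \<union>
           strict_transform F2 C curve_D_inf \<union> strict_transform F2 C (curve_Cq q t)))"

definition S_set :: "complex \<Rightarrow> complex \<Rightarrow> complex \<Rightarrow> complex \<Rightarrow> complex \<Rightarrow> complex set" where
  "S_set q \<Theta>0 \<Theta>1 \<Theta>t \<Theta>inf =
    {s * q powi k | s k.
       s \<in> {\<Theta>1 powi e1 * \<Theta>t powi et | e1 et. e1 \<in> {-1, 1} \<and> et \<in> {-1, 1}} \<union>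
           {\<Theta>0 powi e0 * \<Theta>inf powi ei | e0 ei. e0 \<in> {-1, 1} \<and> ei \<in> {-1, 1}}}"


section \<open>The family over the q-line\<close>

definition Theta :: "complex \<Rightarrow> complex \<Rightarrow> complex" where
  "Theta \<theta> q = 1 + (q - 1) / 2 * \<theta>"

definition omega_curves ::
  "complex \<Rightarrow> complex \<Rightarrow> complex \<Rightarrow> complex \<Rightarrow> complex \<Rightarrow>
     ((complex \<Rightarrow> complex \<Rightarrow> hirz) \<times> (complex \<Rightarrow> complex) \<times> (complex \<Rightarrow> complex)) list" where
  "omega_curves \<theta>0 \<theta>1 \<theta>t \<theta>inf t =
    [(uv, \<lambda>q. 0, \<lambda>q. (- t * \<theta>0 / 2) / Theta \<theta>0 q),
     (uv, \<lambda>q. 0, \<lambda>q. t * \<theta>0 / 2),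
     (uv, \<lambda>q. 1 / Theta \<theta>1 q, \<lambda>q. (- (\<theta>1 / 2) * (t - 1 / Theta \<theta>1 q)) / Theta \<theta>1 q),
     (uv, \<lambda>q. Theta \<theta>1 q, \<lambda>q. \<theta>1 * (t - Theta \<theta>1 q) / 2),
     (uv, \<lambda>q. t * Theta \<theta>t q, \<lambda>q. - (t * \<theta>t / 2) * (t * Theta \<theta>t q - 1)),
     (uv, \<lambda>q. t / Theta \<theta>t q, \<lambda>q. (t * (t - Theta \<theta>t q) * \<theta>t / 2) / (Theta \<theta>t q)\<^sup>2),
     (uv2, \<lambda>q. 0, \<lambda>q. (- \<theta>inf / 2) / Theta \<theta>inf q),
     (uv2, \<lambda>q. 0, \<lambda>q. (\<theta>inf / 2 - 1) / q)]"

text \<open>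
  The open set of those \<open>q \<in> \<complex>\<^sup>*\<close> for which the eight curves are defined and do not meet;
  over it the order of the blow-ups is immaterial.
\<close>

definition omega_base ::
  "complex \<Rightarrow> complex \<Rightarrow> complex \<Rightarrow> complex \<Rightarrow> complex \<Rightarrow> complex set" where
  "omega_base \<theta>0 \<theta>1 \<theta>t \<theta>inf t =
    {q. q \<noteq> 0 \<and> Theta \<theta>0 q \<noteq> 0 \<and> Theta \<theta>1 q \<noteq> 0 \<and> Theta \<theta>t q \<noteq> 0 \<and> Theta \<theta>inf q \<noteq> 0 \<and>
        distinct (map (\<lambda>(\<psi>, a, b). \<psi> (a q) (b q)) (omega_curves \<theta>0 \<theta>1 \<theta>t \<theta>inf t))}"

definition times_atlas :: "complex set \<Rightarrow> ('a, 2) atlas \<Rightarrow> (complex \<times> 'a, 3) atlas" where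
  "times_atlas B A = (\<lambda>(U, \<phi>). (B \<times> U, \<lambda>(q, p). vector [\<phi> p $ 1, \<phi> p $ 2, q])) ` A"

definition curve_centre ::
  "complex set \<Rightarrow> (complex \<Rightarrow> complex \<Rightarrow> hirz) \<times> (complex \<Rightarrow> complex) \<times> (complex \<Rightarrow> complex) \<Rightarrow>
     (complex \<times> hirz, 3) chart" where
  "curve_centre B = (\<lambda>(\<psi>, a, b).
     (B \<times> param_dom \<psi>,
      \<lambda>(q, p). vector [param_inv \<psi> p $ 1 - a q, param_inv \<psi> p $ 2 - b q, q]))"

definition surface_C :: "complex \<Rightarrow> (complex \<times> hirz) set" where
  "surface_C t = atlas_topology (times_atlas (- {0}) F2) closure_of
     {(q, uv u v) | q u v. q \<noteq> 0 \<and> (u - 1) * (u - t) = (1 - q) * v}"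

definition Omega ::
  "complex \<Rightarrow> complex \<Rightarrow> complex \<Rightarrow> complex \<Rightarrow> complex \<Rightarrow> ((complex \<times> hirz) blown, 3) atlas" where
  "Omega \<theta>0 \<theta>1 \<theta>t \<theta>inf t =
    (let B = omega_base \<theta>0 \<theta>1 \<theta>t \<theta>inf t;
         M = times_atlas B F2;
         C = curve_centre B ` set (omega_curves \<theta>0 \<theta>1 \<theta>t \<theta>inf t)
     in remove_closed (blowup M C)
          (strict_transform M C (B \<times> curve_H) \<union>
           strict_transform M C (surface_C t \<inter> B \<times> UNIV) \<union>
           strict_transform M C (B \<times> curve_D 0) \<union>
           strict_transform M C (B \<times> curve_D_inf)))"

definition fibre :: "((complex \<times> 'a) blown, 'n::finite) atlas \<Rightarrow> complex \<Rightarrow> (complex \<times> 'a) blown set" where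
  "fibre X q0 = {x \<in> points X. fst (down x) = q0}"

text \<open>
  The identification of a fibre with a surface: a biholomorphic map compatible with the
  blow-down maps to the common surface underneath.
\<close>

definition fibre_is :: "((complex \<times> 'a) blown, 3) atlas \<Rightarrow> complex \<Rightarrow> ('a blown, 2) atlas \<Rightarrow> bool" where
  "fibre_is X q0 Y \<longleftrightarrow>
     (\<exists>f. biholomorphic_between X (fibre X q0) Y (points Y) f \<and>
          (\<forall>x\<in>fibre X q0. down (f x) = snd (down x)))"

end

theory Submission
  imports Defs
begin

text \<open>
  Slicing the family at \<open>q\<^sub>0\<close> is compatible with every chart: the chart \<open>(x, y / x, q)\<close> of the blow-up
  along the curves restricts to the chart \<open>(x, y / x)\<close> of the blow-up at their values at \<open>q\<^sub>0\<close>, so the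
  obvious bijection is holomorphic both ways once the discarded sets correspond. These are compared with
  an explicit set. Off the exceptional divisors only points \<open>uv u v\<close> with \<open>u \<noteq> 0\<close> and
  \<open>(u - 1)(u - t) \<noteq> (1 - q)v\<close> survive. Over a curve \<open>(a, b)\<close> lying on the surface, put \<open>u = a + x\<close>,
  \<open>v = b + y\<close>; the equation becomes \<open>x(2a - 1 - t + x) = (1 - q)y\<close>, so its strict transform meets the
  exceptional fibre exactly in the direction \<open>x(2a - 1 - t) = (1 - q)y\<close>, which at \<open>q = 1\<close> is the vertical
  direction of the ruling over \<open>u = a\<close>. In the charts the explicit surviving set is open, which
  bounds the strict transforms from above (in the threefold); sequences inside one fibre bound them from
  below (in the surface); continuity of the inclusion of the fibre closes the circle.
\<close>


section \<open>Slices of three-dimensional atlases\<close>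

text \<open>\<open>holomorphic_map_on\<close> asks for genuinely open sets in coordinate space,
  whereas the discarded sets are closures in a topology generated by all charts at once. Passing
  directly from one to the other would require the continuity of every coordinate change of the
  blown-up threefold. Instead each surviving point gets one chart in which the survivors have an
  explicit open image, cut out by the non-vanishing of a few continuous expressions. The explicit
  set is shown to be the full complement of the discarded one only on the fibre in question; on
  neighbouring fibres the two are merely disjoint, which suffices for an open neighbourhood. No
  closure has to be computed at infinity: a point without finite coordinates u, v lies on
  \<open>curve_H\<close> or \<open>curve_D_inf\<close>, which are discarded anyway. The fibre q = 1
  is separate because the equation of the surface degenerates there to (u - 1)(u - t) = 0, two
  rulings in place of a graph over u. The limit of the tangent direction is still determined, since
  2a - 1 - t is nonzero at a = 1 and a = t when t \<noteq> 1.\<close>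

definition extend :: "complex^2 \<Rightarrow> complex \<Rightarrow> complex^3" where
  "extend y q = vector [y $ 1, y $ 2, q]"

definition forget3 :: "complex^3 \<Rightarrow> complex^2" where
  "forget3 x = vector [x $ 1, x $ 2]"

lemma extend_nth [simp]: "extend y q $ 1 = y $ 1" "extend y q $ 2 = y $ 2" "extend y q $ 3 = q"
  by (simp_all add: extend_def)

lemma forget3_nth [simp]: "forget3 x $ 1 = x $ 1" "forget3 x $ 2 = x $ 2"
  by (simp_all add: forget3_def)

lemma forget3_extend [simp]: "forget3 (extend y q) = y"
  by (simp add: vec_eq_iff forall_2)

lemma extend_inject [simp]: "extend y q = extend y' q' \<longleftrightarrow> y = y' \<and> q = q'"
  by (auto simp add: vec_eq_iff forall_3 forall_2)

lemma has_derivative_forget3: "(forget3 has_derivative forget3) (at x)"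
proof -
  have "linear forget3"
    by (rule linearI) (simp_all add: vec_eq_iff forall_2)
  then show ?thesis
    by (simp add: bounded_linear_imp_has_derivative linear_conv_bounded_linear)
qed

lemma has_derivative_extend: "((\<lambda>y. extend y q) has_derivative (\<lambda>h. extend h 0)) (at y)"
proof -
  have "linear (\<lambda>h. extend h 0)"
    by (rule linearI) (simp_all add: vec_eq_iff forall_3)
  then have "((\<lambda>h. extend h 0) has_derivative (\<lambda>h. extend h 0)) (at y)"
    by (simp add: bounded_linear_imp_has_derivative linear_conv_bounded_linear)
  then have "((\<lambda>y. extend y 0 + extend 0 q) has_derivative (\<lambda>h. extend h 0)) (at y)"
    by (auto intro: derivative_eq_intros)
  moreover have "(\<lambda>y. extend y 0 + extend 0 q) = (\<lambda>y. extend y q)"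
    by (simp add: fun_eq_iff vec_eq_iff forall_3)
  ultimately show ?thesis by simp
qed

lemma continuous_on_extend: "continuous_on S (\<lambda>y. extend y q)"
  by (intro continuous_at_imp_continuous_on ballI has_derivative_continuous[OF has_derivative_extend])

lemma continuous_on_forget3: "continuous_on S forget3"
  by (intro continuous_at_imp_continuous_on ballI has_derivative_continuous[OF has_derivative_forget3])

lemma openin_atlas_chart:
  assumes "(U, \<phi>) \<in> A" "open N"
  shows "openin (atlas_topology A) {p \<in> U. \<phi> p \<in> N}"
  unfolding atlas_topology_def using assms by (intro topology_generated_by_Basis) blast

lemma topspace_atlas: "topspace (atlas_topology A) = points A"
proof -
  have "\<Union>{W. \<exists>(U, \<phi>)\<in>A. \<exists>O'. open O' \<and> W = {p \<in> U. \<phi> p \<in> O'}} = points A" (is "\<Union>?F = _")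
  proof (intro equalityI subsetI)
    fix x assume "x \<in> points A"
    then obtain U \<phi> where U: "(U, \<phi>) \<in> A" "x \<in> U" by (auto simp: points_def)
    then have "{p \<in> U. \<phi> p \<in> UNIV} \<in> ?F" by blast
    then show "x \<in> \<Union>?F" using U by blast
  qed (auto simp: points_def)
  then show ?thesis by (simp add: atlas_topology_def topology_generated_by_topspace)
qed

text \<open>In the given charts \<open>f\<close> forgets the third coordinate and its inverse
  inserts \<open>q0\<close>, so both are restrictions of linear or affine maps. \<open>N\<close>
  stands in for openness of the image of \<open>U\<close>, because \<open>U\<close> may be a chart
  domain with points taken out. The disjunction has two uses: \<open>\<phi> z $ 3 = q0\<close>
  places the slice of \<open>N\<close> inside \<open>\<psi>\<close>
  V\<open>, and membership in\<close>e \<open>points Y\<close> makes the local extension agree with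
  \<open>f\<close>.\<close>

lemma biholomorphic_slice:
  fixes X :: "('a, 3) atlas" and Y :: "('b, 2) atlas"
  assumes f: "\<And>y. y \<in> points Y \<Longrightarrow> f (e y) = y"
    and charts: "\<And>y. y \<in> points Y \<Longrightarrow> \<exists>U \<phi> V \<psi> N. (U, \<phi>) \<in> X \<and> (V, \<psi>) \<in> Y \<and> y \<in> V \<and>
      inj_on \<phi> U \<and> inj_on \<psi> V \<and> (\<forall>z\<in>V. e z \<in> U \<and> \<phi> (e z) = extend (\<psi> z) q0) \<and>
      (\<forall>z\<in>U. z \<in> e ` points Y \<or> \<phi> z $ 3 = q0 \<longrightarrow> z \<in> e ` V) \<and> open N \<and> \<phi> (e y) \<in> N \<and> N \<subseteq> \<phi> ` U"
  shows "biholomorphic_between X (e ` points Y) Y (points Y) f"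
proof -
  let ?S = "e ` points Y"
  have inj: "inj_on f ?S" by (rule inj_onI) (auto simp: f)
  have bij: "bij_betw f ?S (points Y)"
    unfolding bij_betw_def using inj f by force
  have g: "inv_into ?S f y = e y" if "y \<in> points Y" for y
    by (rule inv_into_f_eq[OF inj]) (use that f in auto)
  have local: "(\<exists>W F. e y \<in> W \<and> holomorphic_map_on X Y W F \<and> (\<forall>x\<in>?S \<inter> W. F x = f x)) \<and>
      (\<exists>W F. y \<in> W \<and> holomorphic_map_on Y X W F \<and> (\<forall>x\<in>points Y \<inter> W. F x = inv_into ?S f x))"
    if y: "y \<in> points Y" for y
  proof -
    obtain U \<phi> V \<psi> N where c: "(U, \<phi>) \<in> X" "(V, \<psi>) \<in> Y" "y \<in> V" "inj_on \<phi> U" "inj_on \<psi> V"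
      and eV: "\<And>z. z \<in> V \<Longrightarrow> e z \<in> U" "\<And>z. z \<in> V \<Longrightarrow> \<phi> (e z) = extend (\<psi> z) q0"
      and U3: "\<And>z. z \<in> U \<Longrightarrow> z \<in> e ` points Y \<or> \<phi> z $ 3 = q0 \<Longrightarrow> z \<in> e ` V"
      and N: "open N" "\<phi> (e y) \<in> N" "N \<subseteq> \<phi> ` U"
      using charts[OF y] by metis
    \<comment> \<open>The slice of \<open>N\<close> at third coordinate \<open>q0\<close>, which
      supplies the open set of coordinates on the surface.\<close>
    define N2 where "N2 = (\<lambda>w. extend w q0) -` N"
    have N2: "open N2"
      unfolding N2_def using N(1) continuous_on_extend[of UNIV] by (rule open_vimage)
    have N2V: "N2 \<subseteq> \<psi> ` V"
    proof
      fix w assume "w \<in> N2"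
      then have "extend w q0 \<in> N" by (simp add: N2_def)
      then obtain z where z: "z \<in> U" "\<phi> z = extend w q0" using N(3) by (metis imageE subsetD)
      then obtain z' where z': "z' \<in> V" "z = e z'" using U3[OF z(1)] by auto
      have "extend (\<psi> z') q0 = extend w q0" using eV(2)[OF z'(1)] z z' by simp
      then show "w \<in> \<psi> ` V" using z'(1) by auto
    qed
    have yN2: "\<psi> y \<in> N2" using N(2) eV(2)[OF c(3)] by (simp add: N2_def)
    define N1 where "N1 = N \<inter> forget3 -` N2"
    have N1: "open N1" unfolding N1_def
      by (intro open_Int N(1) open_vimage[OF N2 continuous_on_forget3])
    have VY: "V \<subseteq> points Y" using c(2) by (auto simp: points_def)
    show ?thesis
    proof
      \<comment> \<open>The extension of \<open>f\<close> off the slice: project along the third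
        coordinate.\<close>
      let ?W = "{z \<in> U. \<phi> z \<in> N1}" and ?F = "\<lambda>z. inv_into V \<psi> (forget3 (\<phi> z))"
      have "holomorphic_map_on X Y ?W ?F"
        unfolding holomorphic_map_on_def
      proof (intro conjI ballI)
        show "openin (atlas_topology X) ?W" by (rule openin_atlas_chart[OF c(1) N1])
        fix p assume p: "p \<in> ?W"
        have inV: "inv_into V \<psi> w \<in> V" "\<psi> (inv_into V \<psi> w) = w" if "w \<in> N2" for w
          using that N2V by (auto intro: inv_into_into f_inv_into_f)
        have inU: "\<phi> (inv_into U \<phi> x) = x" if "x \<in> N1" for x
          using that N(3) by (auto simp: N1_def intro: f_inv_into_f)
        have pV: "?F p \<in> V" using p inV by (auto simp: N1_def)
        have "N1 \<subseteq> \<phi> ` (U \<inter> ?W)" using N(3) by (auto simp: N1_def)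
        moreover have "\<forall>x\<in>N1. ?F (inv_into U \<phi> x) \<in> V"
          using inV inU by (auto simp: N1_def)
        moreover have "holomorphic_vec_on (\<lambda>x. \<psi> (?F (inv_into U \<phi> x))) N1"
          unfolding holomorphic_vec_on_def
        proof (intro ballI exI conjI allI)
          fix x assume x: "x \<in> N1"
          show "((\<lambda>x. \<psi> (?F (inv_into U \<phi> x))) has_derivative forget3) (at x)"
            by (rule has_derivative_transform_within_open[OF has_derivative_forget3 N1 x])
              (use inV inU in \<open>auto simp: N1_def\<close>)
          show "forget3 (c *s w) = c *s forget3 w" for c w
            by (simp add: vec_eq_iff forall_2)
        qed
        ultimately show "\<exists>(U, \<phi>)\<in>X. \<exists>(V, \<psi>)\<in>Y. p \<in> U \<and> ?F p \<in> V \<and>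
          (\<exists>O'. open O' \<and> \<phi> p \<in> O' \<and> O' \<subseteq> \<phi> ` (U \<inter> ?W) \<and>
            (\<forall>x\<in>O'. ?F (inv_into U \<phi> x) \<in> V) \<and>
            holomorphic_vec_on (\<lambda>x. \<psi> (?F (inv_into U \<phi> x))) O')"
          using p pV N1 by (intro bexI[OF _ c(1)] bexI[OF _ c(2)] case_prodI conjI exI[of _ N1]) auto
      qed
      moreover have "e y \<in> ?W" using eV[OF c(3)] N(2) yN2 by (simp add: N1_def)
      moreover have "?F x = f x" if x: "x \<in> ?S \<inter> ?W" for x
      proof -
        obtain z where z: "z \<in> V" "x = e z" using U3[of x] x by auto
        then show ?thesis
          using eV(2)[OF z(1)] f VY c(5) by (auto simp: inv_into_f_f)
      qed
      ultimately show "\<exists>W F. e y \<in> W \<and> holomorphic_map_on X Y W F \<and> (\<forall>x\<in>?S \<inter> W. F x = f x)"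
        by (intro exI[of _ ?W] exI[of _ ?F]) auto
    next
      show "\<exists>W F. y \<in> W \<and> holomorphic_map_on Y X W F \<and> (\<forall>x\<in>points Y \<inter> W. F x = inv_into ?S f x)"
      proof (intro exI conjI ballI)
        let ?g = "inv_into ?S f" and ?W = "{z \<in> V. \<psi> z \<in> N2}"
        show "y \<in> ?W" using c(3) yN2 by simp
        show "holomorphic_map_on Y X ?W ?g"
          unfolding holomorphic_map_on_def
        proof (intro conjI ballI)
          show "openin (atlas_topology Y) ?W" by (rule openin_atlas_chart[OF c(2) N2])
          fix p assume p: "p \<in> ?W"
          have inV: "inv_into V \<psi> w \<in> V" "\<psi> (inv_into V \<psi> w) = w" if "w \<in> N2" for w
            using that N2V by (auto intro: inv_into_into f_inv_into_f)
          have gV: "?g z = e z" if "z \<in> V" for z using g VY that by auto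
          have pU: "?g p \<in> U" using p eV gV by auto
          have "N2 \<subseteq> \<psi> ` (V \<inter> ?W)" using N2V by auto
          moreover have "\<forall>x\<in>N2. ?g (inv_into V \<psi> x) \<in> U"
            using inV gV eV by auto
          moreover have "holomorphic_vec_on (\<lambda>x. \<phi> (?g (inv_into V \<psi> x))) N2"
            unfolding holomorphic_vec_on_def
          proof (intro ballI exI conjI allI)
            fix x assume x: "x \<in> N2"
            show "((\<lambda>x. \<phi> (?g (inv_into V \<psi> x))) has_derivative (\<lambda>h. extend h 0)) (at x)"
              by (rule has_derivative_transform_within_open[OF has_derivative_extend N2 x, of q0])
                (use inV gV eV in auto)
            show "extend (k *s w) 0 = k *s extend w 0" for k w
              by (simp add: vec_eq_iff forall_3)
          qed
          ultimately show "\<exists>(V, \<psi>)\<in>Y. \<exists>(U, \<phi>)\<in>X. p \<in> V \<and> ?g p \<in> U \<and>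
            (\<exists>O'. open O' \<and> \<psi> p \<in> O' \<and> O' \<subseteq> \<psi> ` (V \<inter> ?W) \<and>
              (\<forall>x\<in>O'. ?g (inv_into V \<psi> x) \<in> U) \<and>
              holomorphic_vec_on (\<lambda>x. \<phi> (?g (inv_into V \<psi> x))) O')"
            using p pU N2 by (intro bexI[OF _ c(2)] bexI[OF _ c(1)] case_prodI conjI exI[of _ N2]) auto
        qed
      qed simp
    qed
  qed
  have fS: "f ` ?S \<subseteq> points Y" "inv_into ?S f ` points Y \<subseteq> ?S" using f g by auto
  show ?thesis
    unfolding biholomorphic_between_def holomorphic_between_def
    using bij fS local by (intro conjI) (auto simp: g)
qed


section \<open>Slices of blow-ups\<close>

text \<open>The last clause ranges over the whole domain of \<open>c\<close>, not only over q: it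
  lets the value of the third coordinate detect the fibre.\<close>

definition slices_to :: "complex \<Rightarrow> (complex \<times> 'a, 3) chart \<Rightarrow> ('a, 2) chart \<Rightarrow> bool" where
  "slices_to q c d \<longleftrightarrow>
     (\<forall>p. (q, p) \<in> fst c \<longleftrightarrow> p \<in> fst d) \<and> (\<forall>p\<in>fst d. snd c (q, p) = extend (snd d p) q) \<and>
     (\<forall>x\<in>fst c. snd c x $ 3 = fst x)"

definition blown_slices_to ::
  "complex \<Rightarrow> ((complex \<times> 'a) blown, 3) chart \<Rightarrow> ('a blown, 2) chart \<Rightarrow> bool" where
  "blown_slices_to q c d \<longleftrightarrow>
     (\<forall>z. map_blown (Pair q) z \<in> fst c \<longleftrightarrow> z \<in> fst d) \<and>
     (\<forall>z\<in>fst d. snd c (map_blown (Pair q) z) = extend (snd d z) q) \<and>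
     (\<forall>z\<in>fst c. snd c z $ 3 = fst (down z))"

lemma set12_extend: "set12 a b (extend w q) = extend (set12 a b w) q"
  by (simp add: set12_def vec_eq_iff forall_3 forall_2)

lemma set12_nth [simp]:
  "(set12 a b w :: complex^3) $ 1 = a" "(set12 a b w :: complex^3) $ 2 = b"
  "(set12 a b w :: complex^3) $ 3 = w $ 3"
  "(set12 a b w' :: complex^2) $ 1 = a" "(set12 a b w' :: complex^2) $ 2 = b"
  by (simp_all add: set12_def)

lemma centre_slice:
  assumes "slices_to q c d" shows "(q, p) \<in> centre c \<longleftrightarrow> p \<in> centre d"
  using assms by (auto simp: slices_to_def centre_def)

lemma centres_slice:
  assumes "\<And>x. x \<in> L \<Longrightarrow> slices_to q (g x) (h x)"
  shows "(q, p) \<in> centres (g ` L) \<longleftrightarrow> p \<in> centres (h ` L)"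
  using centre_slice[OF assms] by (auto simp: centres_def)

text \<open>Both exceptional charts alter only the first two coordinates, hence commute with
  inserting q as the third. Their domains also depend on the whole set of centres, which is why the
  centres of the family and of the fibre are compared in a separate hypothesis.\<close>

lemma exc_charts_slice:
  assumes c: "slices_to q c d" and C: "\<And>p. (q, p) \<in> centres C \<longleftrightarrow> p \<in> centres D"
  shows "blown_slices_to q (exc_chart1 C c) (exc_chart1 D d)"
    and "blown_slices_to q (exc_chart2 C c) (exc_chart2 D d)"
proof -
  obtain U \<phi> V \<psi> where cd: "c = (U, \<phi>)" "d = (V, \<psi>)" by fastforce
  have UV: "\<And>p. (q, p) \<in> U \<longleftrightarrow> p \<in> V" "\<And>p. p \<in> V \<Longrightarrow> \<phi> (q, p) = extend (\<psi> p) q"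
    "\<And>x. x \<in> U \<Longrightarrow> \<phi> x $ 3 = fst x"
    using c by (auto simp: slices_to_def cd)
  have Z: "\<And>p. (q, p) \<in> centre (U, \<phi>) \<longleftrightarrow> p \<in> centre (V, \<psi>)"
    using centre_slice[OF c] by (simp add: cd)
  have ZU: "\<And>x. x \<in> centre (U, \<phi>) \<Longrightarrow> x \<in> U" "\<And>x. x \<in> centre (V, \<psi>) \<Longrightarrow> x \<in> V"
    by (auto simp: centre_def)
  show "blown_slices_to q (exc_chart1 C c) (exc_chart1 D d)"
    unfolding blown_slices_to_def
  proof (intro conjI allI ballI)
    fix z show "map_blown (Pair q) z \<in> fst (exc_chart1 C c) \<longleftrightarrow> z \<in> fst (exc_chart1 D d)"
      by (cases z) (auto simp: exc_chart1_def cd UV Z C)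
  next
    fix z assume "z \<in> fst (exc_chart1 D d)"
    then show "snd (exc_chart1 C c) (map_blown (Pair q) z) = extend (snd (exc_chart1 D d) z) q"
      by (cases z) (auto simp: exc_chart1_def cd UV Z C ZU set12_extend)
  next
    fix z assume "z \<in> fst (exc_chart1 C c)"
    then show "snd (exc_chart1 C c) z $ 3 = fst (down z)"
      by (cases z) (auto simp: exc_chart1_def cd UV Z C ZU)
  qed
  show "blown_slices_to q (exc_chart2 C c) (exc_chart2 D d)"
    unfolding blown_slices_to_def
  proof (intro conjI allI ballI)
    fix z show "map_blown (Pair q) z \<in> fst (exc_chart2 C c) \<longleftrightarrow> z \<in> fst (exc_chart2 D d)"
      by (cases z) (auto simp: exc_chart2_def cd UV Z C)
  next
    fix z assume "z \<in> fst (exc_chart2 D d)"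
    then show "snd (exc_chart2 C c) (map_blown (Pair q) z) = extend (snd (exc_chart2 D d) z) q"
      by (cases z) (auto simp: exc_chart2_def cd UV Z C ZU set12_extend)
  next
    fix z assume "z \<in> fst (exc_chart2 C c)"
    then show "snd (exc_chart2 C c) z $ 3 = fst (down z)"
      by (cases z) (auto simp: exc_chart2_def cd UV Z C ZU)
  qed
qed

lemma off_chart_slice:
  assumes c: "slices_to q (U, \<phi>) (V, \<psi>)" and C: "\<And>p. (q, p) \<in> centres C \<longleftrightarrow> p \<in> centres D"
  shows "blown_slices_to q (Off ` (U - centres C), \<phi> \<circ> down) (Off ` (V - centres D), \<psi> \<circ> down)"
  unfolding blown_slices_to_def
proof (intro conjI allI ballI)
  fix z
  show "map_blown (Pair q) z \<in> fst (Off ` (U - centres C), \<phi> \<circ> down) \<longleftrightarrow>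
      z \<in> fst (Off ` (V - centres D), \<psi> \<circ> down)"
    using c C by (cases z) (auto simp: slices_to_def)
qed (use c C in \<open>auto simp: slices_to_def\<close>)

lemma slices_to_curve_centre:
  assumes "q \<in> B" shows "slices_to q (curve_centre B (\<psi>, a, b)) (point_centre (\<psi>, a q, b q))"
  using assms by (auto simp: slices_to_def curve_centre_def point_centre_def vec_eq_iff forall_3)

lemma slices_to_times_atlas:
  assumes "q \<in> B" "(U, \<phi>) \<in> times_atlas B A"
  obtains V \<psi> where "(V, \<psi>) \<in> A" "slices_to q (U, \<phi>) (V, \<psi>)"
proof -
  from assms(2) obtain V \<psi> where "(V, \<psi>) \<in> A"
    and "U = B \<times> V" "\<phi> = (\<lambda>(q, p). vector [\<psi> p $ 1, \<psi> p $ 2, q])"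
    by (auto simp: times_atlas_def)
  then show thesis
    using assms(1) by (intro that[of V \<psi>]) (auto simp: slices_to_def vec_eq_iff forall_3)
qed

definition fibre_points :: "complex \<Rightarrow> ((complex \<Rightarrow> complex \<Rightarrow> hirz) \<times> (complex \<Rightarrow> complex) \<times> (complex \<Rightarrow> complex)) set \<Rightarrow> (hirz, 2) chart set" where
  "fibre_points q L = (\<lambda>(\<psi>, a, b). point_centre (\<psi>, a q, b q)) ` L"

lemma slices_to_curve_centre':
  assumes "q \<in> B" shows "slices_to q (curve_centre B c) ((\<lambda>(\<psi>, a, b). point_centre (\<psi>, a q, b q)) c)"
  using slices_to_curve_centre[OF assms] by (cases c) auto

lemma centres_fibre_points:
  assumes "q \<in> B" shows "(q, p) \<in> centres (curve_centre B ` L) \<longleftrightarrow> p \<in> centres (fibre_points q L)"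
  unfolding fibre_points_def
  by (rule centres_slice) (rule slices_to_curve_centre'[OF assms])

lemma blowup_chart_slice:
  assumes q: "q \<in> B" and c: "c \<in> blowup (times_atlas B A) (curve_centre B ` L)"
  obtains d where "d \<in> blowup A (fibre_points q L)" "blown_slices_to q c d"
proof -
  let ?C = "curve_centre B ` L" and ?D = "fibre_points q L"
  note Z = centres_fibre_points[OF q, of _ L]
  consider (off) U \<phi> where "(U, \<phi>) \<in> times_atlas B A" "c = (Off ` (U - centres ?C), \<phi> \<circ> down)"
    | (exc) x where "x \<in> L" "c = exc_chart1 ?C (curve_centre B x) \<or> c = exc_chart2 ?C (curve_centre B x)"
    using c by (auto simp: blowup_def)
  then show thesis
  proof cases
    case off
    then obtain V \<psi> where V: "(V, \<psi>) \<in> A" "slices_to q (U, \<phi>) (V, \<psi>)"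
      using slices_to_times_atlas[OF q] by metis
    show thesis
      by (rule that[of "(Off ` (V - centres ?D), \<psi> \<circ> down)"])
        (use V(1) off off_chart_slice[OF V(2) Z] in \<open>auto simp: blowup_def\<close>)
  next
    case exc
    obtain \<psi> a b where x: "x = (\<psi>, a, b)" by (cases x)
    have d: "point_centre (\<psi>, a q, b q) \<in> ?D" using exc x by (force simp: fibre_points_def)
    note s = exc_charts_slice[OF slices_to_curve_centre[OF q] Z]
    show thesis
      using exc(2)
    proof
      assume "c = exc_chart1 ?C (curve_centre B x)"
      then show thesis
        using d s x by (intro that[of "exc_chart1 ?D (point_centre (\<psi>, a q, b q))"]) (auto simp: blowup_def)
    next
      assume "c = exc_chart2 ?C (curve_centre B x)"
      then show thesis
        using d s x by (intro that[of "exc_chart2 ?D (point_centre (\<psi>, a q, b q))"]) (auto simp: blowup_def)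
    qed
  qed
qed

section \<open>Underlying point sets, and continuity of the inclusion of a fibre\<close>

lemma points_blowup:
  fixes A :: "('a, 'n::{finite,numeral}) atlas"
  assumes "\<And>c. c \<in> C \<Longrightarrow> fst c \<subseteq> points A"
  shows "points (blowup A C) = Off ` (points A - centres C) \<union> {Exc p l | p l. p \<in> centres C}"
proof (intro equalityI subsetI)
  fix z assume "z \<in> points (blowup A C)"
  then obtain c where c: "c \<in> blowup A C" "z \<in> fst c" by (auto simp: points_def)
  have exc: "z \<in> Off ` (points A - centres C) \<union> {Exc p l | p l. p \<in> centres C}"
    if d: "d \<in> C" "z \<in> fst (exc_chart1 C d) \<or> z \<in> fst (exc_chart2 C d)" for d
    using d assms[OF d(1)] by (cases z; cases d) (auto simp: exc_chart1_def exc_chart2_def centres_def)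
  have off: "z \<in> Off ` (points A - centres C)"
    if "(U, \<phi>) \<in> A" "z \<in> Off ` (U - centres C)" for U and \<phi> :: "'a \<Rightarrow> (complex, 'n) vec"
    using that by (auto simp: points_def)
  show "z \<in> Off ` (points A - centres C) \<union> {Exc p l | p l. p \<in> centres C}"
    using c exc off unfolding blowup_def by auto
next
  fix z assume "z \<in> Off ` (points A - centres C) \<union> {Exc p l | p l. p \<in> centres C}"
  then consider p where "z = Off p" "p \<in> points A - centres C"
    | p l where "z = Exc p l" "p \<in> centres C" by blast
  then show "z \<in> points (blowup A C)"
  proof cases
    case 1
    then obtain U \<phi> where "(U, \<phi>) \<in> A" "p \<in> U" by (auto simp: points_def)
    then have "(Off ` (U - centres C), \<phi> \<circ> down) \<in> blowup A C" "z \<in> Off ` (U - centres C)"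
      using 1 by (auto simp: blowup_def)
    then show ?thesis unfolding points_def by blast
  next
    case 2
    then obtain c where c: "c \<in> C" "p \<in> centre c" by (auto simp: centres_def)
    show ?thesis
    \<comment> \<open>The direction \<open>None\<close> is visible only in the second exceptional
      chart; every finite direction is visible in the first.\<close>
    proof (cases l)
      case None
      then have "z \<in> fst (exc_chart2 C c)" using 2 c by (cases c) (auto simp: exc_chart2_def)
      then show ?thesis using c(1) by (auto simp: points_def blowup_def split_beta)
    next
      case (Some s)
      then have "z \<in> fst (exc_chart1 C c)" using 2 c by (cases c) (auto simp: exc_chart1_def)
      then show ?thesis using c(1) by (auto simp: points_def blowup_def split_beta)
    qed
  qed
qed

lemma points_F2: "points F2 = UNIV"
proof -
  have "\<exists>\<psi>\<in>{uv, uv1, uv2, uv3}. p \<in> param_dom \<psi>" for p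
  proof -
    obtain x y where p: "p = (x, y)" by (cases p)
    show ?thesis
    proof (cases x; cases y)
      fix u v assume "x = Some u" "y = Some v"
      then have "p = uv u v" by (simp add: p uv_def)
      then show ?thesis by (auto simp: param_dom_def)
    next
      fix u assume "x = Some u" "y = None"
      then have "p = uv1 u 0" by (simp add: p uv1_def)
      then show ?thesis by (auto simp: param_dom_def)
    next
      fix v assume "x = None" "y = Some v"
      then have "p = uv2 0 v" by (simp add: p uv2_def)
      then show ?thesis by (auto simp: param_dom_def)
    next
      assume "x = None" "y = None"
      then have "p = uv3 0 0" by (simp add: p uv3_def)
      then show ?thesis by (auto simp: param_dom_def)
    qed
  qed
  then show ?thesis by (auto simp: points_def F2_def)
qed

lemma points_times_atlas: "points (times_atlas B A) = B \<times> points A"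
  by (auto simp: points_def times_atlas_def)

lemma points_blowup_family:
  "points (blowup (times_atlas B F2) (curve_centre B ` L)) =
    Off ` (B \<times> UNIV - centres (curve_centre B ` L)) \<union> {Exc x l | x l. x \<in> centres (curve_centre B ` L)}"
  by (subst points_blowup) (auto simp: points_times_atlas points_F2 curve_centre_def)

lemma points_blowup_fibre:
  "points (blowup F2 (fibre_points q L)) =
    Off ` (- centres (fibre_points q L)) \<union> {Exc x l | x l. x \<in> centres (fibre_points q L)}"
  by (subst points_blowup) (auto simp: points_F2 point_centre_def)

lemma points_blowup_slice:
  assumes "q \<in> B"
  shows "map_blown (Pair q) z \<in> points (blowup (times_atlas B F2) (curve_centre B ` L)) \<longleftrightarrow>
    z \<in> points (blowup F2 (fibre_points q L))"
  unfolding points_blowup_family points_blowup_fibre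
  using assms centres_fibre_points[OF assms] by (cases z) auto

text \<open>Continuity need only be tested on the generating sets. Such a set is given by a chart
  and an open set of coordinates; its preimage is given by the sliced chart and the preimage of that
  open set under \<open>extend\<close>.\<close>

lemma openin_vimage_fibre:
  assumes q: "q \<in> B" and W: "openin (atlas_topology (blowup (times_atlas B F2) (curve_centre B ` L))) W"
  shows "openin (atlas_topology (blowup F2 (fibre_points q L)))
    (map_blown (Pair q) -` W \<inter> points (blowup F2 (fibre_points q L)))"
proof -
  let ?X = "blowup (times_atlas B F2) (curve_centre B ` L)" and ?Y = "blowup F2 (fibre_points q L)"
  have "continuous_map (atlas_topology ?Y) (atlas_topology ?X) (map_blown (Pair q))"
    unfolding atlas_topology_def[of ?X]
  proof (subst continuous_on_generated_topo_iff, intro conjI allI impI)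
    fix W assume "W \<in> {W. \<exists>(U, \<phi>)\<in>?X. \<exists>O'. open O' \<and> W = {p \<in> U. \<phi> p \<in> O'}}"
    then obtain U \<phi> N where UN: "(U, \<phi>) \<in> ?X" "open N" "W = {p \<in> U. \<phi> p \<in> N}" by blast
    obtain V \<psi> where V: "(V, \<psi>) \<in> ?Y" "blown_slices_to q (U, \<phi>) (V, \<psi>)"
      using blowup_chart_slice[OF q UN(1)] by (metis surj_pair)
    have "map_blown (Pair q) -` W \<inter> topspace (atlas_topology ?Y) =
        {p \<in> V. \<psi> p \<in> (\<lambda>w. extend w q) -` N}"
      using V unfolding UN(3) topspace_atlas points_def by (auto simp: blown_slices_to_def)
    also have "openin (atlas_topology ?Y) \<dots>"
      by (intro openin_atlas_chart[OF V(1)] open_vimage[OF UN(2) continuous_on_extend])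
    finally show "openin (atlas_topology ?Y) (map_blown (Pair q) -` W \<inter> topspace (atlas_topology ?Y))" .
  next
    have "map_blown (Pair q) ` topspace (atlas_topology ?Y) \<subseteq> topspace (atlas_topology ?X)"
      unfolding topspace_atlas using points_blowup_slice[OF q] by blast
    then show "map_blown (Pair q) ` topspace (atlas_topology ?Y) \<subseteq>
      \<Union> {W. \<exists>(U, \<phi>)\<in>?X. \<exists>O'. open O' \<and> W = {p \<in> U. \<phi> p \<in> O'}}"
      unfolding atlas_topology_def[of ?X] topology_generated_by_topspace .
  qed
  then show ?thesis
    using W unfolding continuous_map_alt topspace_atlas by blast
qed


section \<open>Parametrised charts of the family\<close>

lemma param_inv_uv [simp]: "param_inv uv (uv u v) = vector [u, v]"
  unfolding param_inv_def by (rule inv_f_eq) (auto simp: inj_def uv_def vec_eq_iff forall_2)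

lemma uv2_eq_iff: "uv2 u v = uv2 u' v' \<longleftrightarrow> u = u' \<and> v = v'"
  by (auto simp: uv2_def)

lemma param_inv_uv2 [simp]: "param_inv uv2 (uv2 u v) = vector [u, v]"
  unfolding param_inv_def by (rule inv_f_eq) (auto simp: inj_def uv2_eq_iff vec_eq_iff forall_2)

lemma uv_eq_iff: "uv u v = uv u' v' \<longleftrightarrow> u = u' \<and> v = v'"
  by (auto simp: uv_def)

text \<open>The division-free form turns equality of points into polynomial equations;
  \<open>u * u' = 1\<close> already contains that both entries are nonzero.\<close>

lemma uv_eq_uv2_iff: "uv u v = uv2 u' v' \<longleftrightarrow> u * u' = 1 \<and> v' = v * u'\<^sup>2"
  by (auto simp: uv_def uv2_def field_simps)

lemma open_nonzero:
  fixes f :: "'a::topological_space \<Rightarrow> complex"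
  assumes "open S" "continuous_on S f" shows "open {w \<in> S. f w \<noteq> 0}"
proof -
  have "open (f -` (- {0}) \<inter> S)"
    using assms continuous_on_open_vimage[OF assms(1)] by blast
  moreover have "f -` (- {0}) \<inter> S = {w \<in> S. f w \<noteq> 0}" by auto
  ultimately show ?thesis by simp
qed

lemma open_neq:
  fixes f :: "'a::topological_space \<Rightarrow> complex"
  assumes "open S" "continuous_on S f" "continuous_on S g" shows "open {w \<in> S. f w \<noteq> g w}"
  using open_nonzero[of S "\<lambda>w. f w - g w"] assms by (simp add: continuous_on_diff)

text \<open>Equality of two points in these charts is a conjunction of two polynomial equations, so
  its negation is a union of two open conditions. This is the Hausdorff property in the form in
  which the moving centres need it.\<close>

lemma open_separated:
  fixes f g f' g' :: "'a::topological_space \<Rightarrow> complex"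
  assumes \<psi>: "\<psi> \<in> {uv, uv2}" "\<psi>' \<in> {uv, uv2}" and S: "open S"
    and c: "continuous_on S f" "continuous_on S g" "continuous_on S f'" "continuous_on S g'"
  shows "open {w \<in> S. \<psi> (f w) (g w) \<noteq> \<psi>' (f' w) (g' w)}"
proof -
  have disj: "open {w \<in> S. P w \<or> Q w}" if "open {w \<in> S. P w}" "open {w \<in> S. Q w}" for P Q
    using open_Un[OF that] by (simp add: Collect_disj_eq[symmetric] conj_disj_distribL)
  have same: "open {w \<in> S. f w \<noteq> f' w \<or> g w \<noteq> g' w}"
    by (intro disj open_neq S c)
  have mix: "open {w \<in> S. f w * f' w \<noteq> 1 \<or> g' w \<noteq> g w * (f' w)\<^sup>2}"
    by (intro disj open_neq S c continuous_intros)
  have mix': "open {w \<in> S. f' w * f w \<noteq> 1 \<or> g w \<noteq> g' w * (f w)\<^sup>2}"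
    by (intro disj open_neq S c continuous_intros)
  have sym: "uv2 u v = uv u' v' \<longleftrightarrow> u' * u = 1 \<and> v = v' * u\<^sup>2" for u v u' v'
    by (metis uv_eq_uv2_iff)
  show ?thesis
    using \<psi> same mix mix' by (auto simp: uv_eq_iff uv2_eq_iff uv_eq_uv2_iff sym)
qed

text \<open>An explicit inverse \<open>\<iota>\<close> with an explicit coordinate image
  \<open>D\<close>. It turns the image of a subset of a chart into a comprehension over coordinates,
  whose openness can be read off.\<close>

definition chart_param ::
  "('a, 'n::finite) chart \<Rightarrow> (complex^'n) set \<Rightarrow> (complex^'n \<Rightarrow> 'a) \<Rightarrow> bool" where
  "chart_param c D \<iota> \<longleftrightarrow> (\<forall>w\<in>D. \<iota> w \<in> fst c \<and> snd c (\<iota> w) = w) \<and>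
     (\<forall>z\<in>fst c. snd c z \<in> D \<and> \<iota> (snd c z) = z)"

text \<open>The blow-up substitution (x, y) = (w1, w1 w2), with x, y measured from the curve at the
  parameter w3. Its companion below uses (x, y) = (w1 w2, w2), so that the slope y/x is 1/w1 and w1
  = 0 is the vertical direction.\<close>

definition exc_param1 ::
  "(complex \<Rightarrow> complex \<Rightarrow> hirz) \<Rightarrow> (complex \<Rightarrow> complex) \<Rightarrow> (complex \<Rightarrow> complex) \<Rightarrow>
     complex^3 \<Rightarrow> (complex \<times> hirz) blown" where
  "exc_param1 \<psi> a b w =
    (if w $ 1 = 0 then Exc (w $ 3, \<psi> (a (w $ 3)) (b (w $ 3))) (Some (w $ 2))
     else Off (w $ 3, \<psi> (a (w $ 3) + w $ 1) (b (w $ 3) + w $ 1 * w $ 2)))"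

definition exc_param2 ::
  "(complex \<Rightarrow> complex \<Rightarrow> hirz) \<Rightarrow> (complex \<Rightarrow> complex) \<Rightarrow> (complex \<Rightarrow> complex) \<Rightarrow>
     complex^3 \<Rightarrow> (complex \<times> hirz) blown" where
  "exc_param2 \<psi> a b w =
    (if w $ 2 = 0
     then Exc (w $ 3, \<psi> (a (w $ 3)) (b (w $ 3))) (if w $ 1 = 0 then None else Some (1 / w $ 1))
     else Off (w $ 3, \<psi> (a (w $ 3) + w $ 1 * w $ 2) (b (w $ 3) + w $ 2)))"

lemma in_centre_curve_centre:
  assumes "\<And>u v. param_inv \<psi> (\<psi> u v) = vector [u, v]"
  shows "(q, p) \<in> centre (curve_centre B (\<psi>, a, b)) \<longleftrightarrow> q \<in> B \<and> p = \<psi> (a q) (b q)"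
  using assms by (auto simp: centre_def curve_centre_def param_dom_def)

text \<open>The centres are to be avoided only where \<open>w $ 1 \<noteq> 0\<close>: at
  \<open>w $ 1 = 0\<close> the point on the centre has been replaced by a normal direction.\<close>

lemma exc_chart1_param:
  fixes B :: "complex set"
  assumes \<psi>: "\<And>u v. param_inv \<psi> (\<psi> u v) = vector [u, v]"
  shows "chart_param (exc_chart1 C (curve_centre B (\<psi>, a, b)))
    {w. w $ 3 \<in> B \<and> (w $ 1 \<noteq> 0 \<longrightarrow>
       (w $ 3, \<psi> (a (w $ 3) + w $ 1) (b (w $ 3) + w $ 1 * w $ 2)) \<notin> centres C)}
    (exc_param1 \<psi> a b)"
  unfolding chart_param_def
proof (intro conjI ballI)
  fix z assume z: "z \<in> fst (exc_chart1 C (curve_centre B (\<psi>, a, b)))"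
  note Z = in_centre_curve_centre[OF \<psi>, of _ _ B a b]
  have *: "snd (exc_chart1 C (curve_centre B (\<psi>, a, b))) z \<in>
     {w. w $ 3 \<in> B \<and> (w $ 1 \<noteq> 0 \<longrightarrow>
       (w $ 3, \<psi> (a (w $ 3) + w $ 1) (b (w $ 3) + w $ 1 * w $ 2)) \<notin> centres C)} \<and>
     exc_param1 \<psi> a b (snd (exc_chart1 C (curve_centre B (\<psi>, a, b))) z) = z"
  proof (cases z)
    case (Off x)
    obtain q p where x: "x = (q, p)" by (cases x)
    obtain u v where "p = \<psi> u v" "q \<in> B" "u \<noteq> a q" "(q, \<psi> u v) \<notin> centres C"
      using z by (auto simp: Off x exc_chart1_def curve_centre_def param_dom_def \<psi>)
    then show ?thesis
      by (auto simp: Off x exc_chart1_def exc_param1_def curve_centre_def \<psi>)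
  next
    case (Exc x l)
    then show ?thesis
      using z by (auto simp: exc_chart1_def exc_param1_def curve_centre_def Z[unfolded curve_centre_def, simplified] \<psi>)
  qed
  then show "snd (exc_chart1 C (curve_centre B (\<psi>, a, b))) z \<in>
     {w. w $ 3 \<in> B \<and> (w $ 1 \<noteq> 0 \<longrightarrow>
       (w $ 3, \<psi> (a (w $ 3) + w $ 1) (b (w $ 3) + w $ 1 * w $ 2)) \<notin> centres C)}"
    "exc_param1 \<psi> a b (snd (exc_chart1 C (curve_centre B (\<psi>, a, b))) z) = z" by blast+
next
  fix w :: "complex^3"
  assume w: "w \<in> {w. w $ 3 \<in> B \<and> (w $ 1 \<noteq> 0 \<longrightarrow>
       (w $ 3, \<psi> (a (w $ 3) + w $ 1) (b (w $ 3) + w $ 1 * w $ 2)) \<notin> centres C)}"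
  note Z = in_centre_curve_centre[OF \<psi>, of _ _ B a b]
  show "exc_param1 \<psi> a b w \<in> fst (exc_chart1 C (curve_centre B (\<psi>, a, b)))"
    using w by (auto simp: exc_chart1_def exc_param1_def curve_centre_def param_dom_def \<psi>
        Z[unfolded curve_centre_def param_dom_def, simplified] simp del: split_paired_Ex)
  show "snd (exc_chart1 C (curve_centre B (\<psi>, a, b))) (exc_param1 \<psi> a b w) = w"
    using w by (auto simp: exc_chart1_def exc_param1_def curve_centre_def \<psi> vec_eq_iff forall_3)
qed

lemma exc_chart2_param:
  fixes B :: "complex set"
  assumes \<psi>: "\<And>u v. param_inv \<psi> (\<psi> u v) = vector [u, v]"
  shows "chart_param (exc_chart2 C (curve_centre B (\<psi>, a, b)))
    {w. w $ 3 \<in> B \<and> (w $ 2 \<noteq> 0 \<longrightarrow>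
       (w $ 3, \<psi> (a (w $ 3) + w $ 1 * w $ 2) (b (w $ 3) + w $ 2)) \<notin> centres C)}
    (exc_param2 \<psi> a b)"
  unfolding chart_param_def
proof (intro conjI ballI)
  fix z assume z: "z \<in> fst (exc_chart2 C (curve_centre B (\<psi>, a, b)))"
  note Z = in_centre_curve_centre[OF \<psi>, of _ _ B a b]
  have *: "snd (exc_chart2 C (curve_centre B (\<psi>, a, b))) z \<in>
     {w. w $ 3 \<in> B \<and> (w $ 2 \<noteq> 0 \<longrightarrow>
       (w $ 3, \<psi> (a (w $ 3) + w $ 1 * w $ 2) (b (w $ 3) + w $ 2)) \<notin> centres C)} \<and>
     exc_param2 \<psi> a b (snd (exc_chart2 C (curve_centre B (\<psi>, a, b))) z) = z"
  proof (cases z)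
    case (Off x)
    obtain q p where x: "x = (q, p)" by (cases x)
    obtain u v where "p = \<psi> u v" "q \<in> B" "v \<noteq> b q" "(q, \<psi> u v) \<notin> centres C"
      using z by (auto simp: Off x exc_chart2_def curve_centre_def param_dom_def \<psi>)
    then show ?thesis
      by (auto simp: Off x exc_chart2_def exc_param2_def curve_centre_def \<psi>)
  next
    case (Exc x l)
    then show ?thesis
      using z by (cases l) (auto simp: exc_chart2_def exc_param2_def curve_centre_def Z[unfolded curve_centre_def, simplified] \<psi>)
  qed
  then show "snd (exc_chart2 C (curve_centre B (\<psi>, a, b))) z \<in>
     {w. w $ 3 \<in> B \<and> (w $ 2 \<noteq> 0 \<longrightarrow>
       (w $ 3, \<psi> (a (w $ 3) + w $ 1 * w $ 2) (b (w $ 3) + w $ 2)) \<notin> centres C)}"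
    "exc_param2 \<psi> a b (snd (exc_chart2 C (curve_centre B (\<psi>, a, b))) z) = z" by blast+
next
  fix w :: "complex^3"
  assume w: "w \<in> {w. w $ 3 \<in> B \<and> (w $ 2 \<noteq> 0 \<longrightarrow>
       (w $ 3, \<psi> (a (w $ 3) + w $ 1 * w $ 2) (b (w $ 3) + w $ 2)) \<notin> centres C)}"
  note Z = in_centre_curve_centre[OF \<psi>, of _ _ B a b]
  show "exc_param2 \<psi> a b w \<in> fst (exc_chart2 C (curve_centre B (\<psi>, a, b)))"
    using w by (auto simp: exc_chart2_def exc_param2_def curve_centre_def param_dom_def \<psi>
        Z[unfolded curve_centre_def param_dom_def, simplified] simp del: split_paired_Ex)
  show "snd (exc_chart2 C (curve_centre B (\<psi>, a, b))) (exc_param2 \<psi> a b w) = w"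
    using w by (auto simp: exc_chart2_def exc_param2_def curve_centre_def \<psi> vec_eq_iff forall_3)
qed

lemma off_chart_param:
  "chart_param (Off ` (B \<times> param_dom uv - centres C), (\<lambda>(q, p). vector [param_inv uv p $ 1, param_inv uv p $ 2, q]) \<circ> down)
    {w :: complex^3. w $ 3 \<in> B \<and> (w $ 3, uv (w $ 1) (w $ 2)) \<notin> centres C} (\<lambda>w. Off (w $ 3, uv (w $ 1) (w $ 2)))"
  by (auto simp: chart_param_def param_dom_def vec_eq_iff forall_3 simp del: split_paired_Ex)

text \<open>
  The fibre over \<open>q\<close> of the open part of the blow-up. In the last case \<open>u \<noteq> 0\<close>, and the centre is taken
  to lie on \<open>(u - 1)(u - t) = (1 - q)v\<close>, whose tangent direction is excluded.
\<close>

fun kept :: "complex \<Rightarrow> complex \<Rightarrow> hirz blown \<Rightarrow> bool" where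
  "kept t q (Off p) \<longleftrightarrow> (\<exists>u v. p = uv u v \<and> u \<noteq> 0 \<and> (u - 1) * (u - t) \<noteq> (1 - q) * v)"
| "kept t q (Exc p l) \<longleftrightarrow>
     (case fst p of
        None \<Rightarrow> l \<noteq> None
      | Some u \<Rightarrow>
          if u = 0 then l \<noteq> None
          else case l of None \<Rightarrow> q \<noteq> 1 | Some s \<Rightarrow> (1 - q) * s \<noteq> 2 * u - 1 - t)"

definition family_kept :: "complex \<Rightarrow> (complex \<times> hirz) blown set" where
  "family_kept t = {z. kept t (fst (down z)) (map_blown snd z)}"

lemma kept_Off_uv: "kept t q (Off (uv u v)) \<longleftrightarrow> u \<noteq> 0 \<and> (u - 1) * (u - t) \<noteq> (1 - q) * v"
  by (auto simp: uv_eq_iff)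

text \<open>Clearing the denominator \<open>u\<^sup>2\<close> gives the equation of the surface in
  this chart. Here \<open>u \<noteq> 0\<close> excludes the ruling over infinity, while the ruling
  over 0 lies outside the chart.\<close>

lemma kept_Off_uv2:
  "kept t q (Off (uv2 u v)) \<longleftrightarrow> u \<noteq> 0 \<and> (1 - u) * (1 - t * u) \<noteq> (1 - q) * v"
proof (cases "u = 0")
  case True
  then show ?thesis by (auto simp: uv_def uv2_def)
next
  case False
  then have "uv2 u v = uv (1 / u) (v / u\<^sup>2)" by (simp add: uv_def uv2_def)
  moreover have "(1 / u - 1) * (1 / u - t) = (1 - q) * (v / u\<^sup>2) \<longleftrightarrow> (1 - u) * (1 - t * u) = (1 - q) * v"
    using False by (simp add: field_simps power2_eq_square)
  ultimately show ?thesis using False kept_Off_uv by simp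
qed

lemma kept_Exc_uv:
  "kept t q (Exc (uv u v) l) \<longleftrightarrow>
    (if u = 0 then l \<noteq> None else case l of None \<Rightarrow> q \<noteq> 1 | Some s \<Rightarrow> (1 - q) * s \<noteq> 2 * u - 1 - t)"
  by (simp add: uv_def)

lemma kept_Exc_uv2: "kept t q (Exc (uv2 0 v) l) \<longleftrightarrow> l \<noteq> None"
  by (simp add: uv2_def)

declare kept.simps [simp del]

lemma open_Collect_Int: "open {w \<in> S. P w} \<Longrightarrow> open {w \<in> S. Q w} \<Longrightarrow> open {w \<in> S. P w \<and> Q w}"
  using open_Int[of "{w \<in> S. P w}" "{w \<in> S. Q w}"] by (simp add: Int_def conj_ac cong: conj_cong)

text \<open>The properties of the eight curves on which the geometry rests. A curve lies either on
  the ruling over 0, or on the ruling over infinity, or on the surface away from the ruling over 0.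
  The two inequalities say that curves of the first two kinds miss the surface, whose equation reads
  t = (1 - q) v at u = 0 and 1 = (1 - q) v at infinity in the chart \<open>uv2\<close>. Hence over
  each centre exactly one kind of discarded surface matters.\<close>

locale marked_family =
  fixes B :: "complex set" and t :: complex
    and L :: "((complex \<Rightarrow> complex \<Rightarrow> hirz) \<times> (complex \<Rightarrow> complex) \<times> (complex \<Rightarrow> complex)) set"
  assumes open_base: "open B" and finite_curves: "finite L"
    and continuous_curves:
      "\<And>\<psi> a b. (\<psi>, a, b) \<in> L \<Longrightarrow> continuous_on B a" "\<And>\<psi> a b. (\<psi>, a, b) \<in> L \<Longrightarrow> continuous_on B b"
    and curve_cases: "\<And>\<psi> a b. (\<psi>, a, b) \<in> L \<Longrightarrow>
      \<psi> = uv \<and> (\<forall>q\<in>B. a q = 0 \<and> t \<noteq> (1 - q) * b q) \<or>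
      \<psi> = uv2 \<and> (\<forall>q\<in>B. a q = 0 \<and> 1 \<noteq> (1 - q) * b q) \<or>
      \<psi> = uv \<and> (\<forall>q\<in>B. a q \<noteq> 0 \<and> (a q - 1) * (a q - t) = (1 - q) * b q)"
    and disjoint_curves: "\<And>\<psi> a b \<psi>' a' b' q. (\<psi>, a, b) \<in> L \<Longrightarrow> (\<psi>', a', b') \<in> L \<Longrightarrow> q \<in> B \<Longrightarrow>
      \<psi> (a q) (b q) = \<psi>' (a' q) (b' q) \<Longrightarrow> (\<psi>, a, b) = (\<psi>', a', b')"
begin

abbreviation "C \<equiv> curve_centre B ` L"
abbreviation "X \<equiv> blowup (times_atlas B F2) C"

lemma chart_cases: "(\<psi>, a, b) \<in> L \<Longrightarrow> \<psi> \<in> {uv, uv2}"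
  using curve_cases by blast

lemma param_inv_curve: "(\<psi>, a, b) \<in> L \<Longrightarrow> param_inv \<psi> (\<psi> u v) = vector [u, v]"
  using chart_cases by fastforce

lemma chart_inject: "(\<psi>, a, b) \<in> L \<Longrightarrow> \<psi> u v = \<psi> u' v' \<longleftrightarrow> u = u' \<and> v = v'"
  using chart_cases uv_eq_iff uv2_eq_iff by fastforce

lemma in_centres: "(q, p) \<in> centres C \<longleftrightarrow> q \<in> B \<and> (\<exists>(\<psi>, a, b)\<in>L. p = \<psi> (a q) (b q))"
proof -
  have "(q, p) \<in> centres C \<longleftrightarrow> (\<exists>x\<in>L. (q, p) \<in> centre (curve_centre B x))"
    by (simp add: centres_def)
  also have "\<dots> \<longleftrightarrow> (\<exists>(\<psi>, a, b)\<in>L. q \<in> B \<and> p = \<psi> (a q) (b q))"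
    by (intro bex_cong refl) (auto simp: in_centre_curve_centre[OF param_inv_curve])
  finally show ?thesis by blast
qed

abbreviation "over_base \<equiv> {w :: complex^3. w $ 3 \<in> B}"

lemma open_over_base: "open over_base"
  using open_vimage[OF open_base, of "\<lambda>w :: complex^3. w $ 3"] by (simp add: vimage_def continuous_intros)

lemma continuous_on_curve:
  assumes "(\<psi>, a, b) \<in> L"
  shows "continuous_on over_base (\<lambda>w. a (w $ 3))" "continuous_on over_base (\<lambda>w. b (w $ 3))"
proof -
  have *: "continuous_on over_base (\<lambda>w :: complex^3. w $ 3)" by (intro continuous_intros)
  show "continuous_on over_base (\<lambda>w. a (w $ 3))"
    by (rule continuous_on_compose2[OF continuous_curves(1)[OF assms] *]) auto
  show "continuous_on over_base (\<lambda>w. b (w $ 3))"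
    by (rule continuous_on_compose2[OF continuous_curves(2)[OF assms] *]) auto
qed

lemma open_off_centres:
  assumes "L' \<subseteq> L" "\<psi> \<in> {uv, uv2}" and f: "continuous_on over_base f" "continuous_on over_base g"
  shows "open {w \<in> over_base. \<forall>(\<psi>', a', b')\<in>L'. \<psi> (f w) (g w) \<noteq> \<psi>' (a' (w $ 3)) (b' (w $ 3))}"
proof -
  have "open (over_base \<inter> (\<Inter>(\<psi>', a', b')\<in>L'. {w \<in> over_base. \<psi> (f w) (g w) \<noteq> \<psi>' (a' (w $ 3)) (b' (w $ 3))}))"
  proof (intro open_Int open_over_base open_INT ballI)
    show "finite L'" using assms(1) finite_curves finite_subset by blast
    fix x assume "x \<in> L'"
    then obtain \<psi>' a' b' where x: "x = (\<psi>', a', b')" "(\<psi>', a', b') \<in> L" using assms(1) by (cases x) auto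
    show "open (case x of (\<psi>', a', b') \<Rightarrow> {w \<in> over_base. \<psi> (f w) (g w) \<noteq> \<psi>' (a' (w $ 3)) (b' (w $ 3))})"
      unfolding x(1) prod.case
      using open_separated[OF assms(2) chart_cases[OF x(2)] open_over_base f continuous_on_curve[OF x(2)]] .
  qed
  moreover have "over_base \<inter> (\<Inter>(\<psi>', a', b')\<in>L'. {w \<in> over_base. \<psi> (f w) (g w) \<noteq> \<psi>' (a' (w $ 3)) (b' (w $ 3))}) =
    {w \<in> over_base. \<forall>(\<psi>', a', b')\<in>L'. \<psi> (f w) (g w) \<noteq> \<psi>' (a' (w $ 3)) (b' (w $ 3))}"
    by (fastforce simp: split_beta)
  ultimately show ?thesis by simp
qed

text \<open>
  At points with \<open>f w = g w = 0\<close> the condition to avoid the other centres holds automatically, as the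
  curves are disjoint; imposing it there too gives a manifestly open condition.
\<close>

lemma open_exc_domain:
  assumes c: "(\<psi>, a, b) \<in> L" and f: "continuous_on over_base f" "continuous_on over_base g"
    and P: "\<And>w. P w \<longleftrightarrow> \<not> (f w = 0 \<and> g w = 0)"
  shows "open {w. w $ 3 \<in> B \<and> (P w \<longrightarrow> (w $ 3, \<psi> (a (w $ 3) + f w) (b (w $ 3) + g w)) \<notin> centres C)}"
proof -
  note cont = continuous_on_add[OF continuous_on_curve(1)[OF c] f(1)]
    continuous_on_add[OF continuous_on_curve(2)[OF c] f(2)]
  have "open {w \<in> over_base. \<forall>(\<psi>', a', b')\<in>L - {(\<psi>, a, b)}.
      \<psi> (a (w $ 3) + f w) (b (w $ 3) + g w) \<noteq> \<psi>' (a' (w $ 3)) (b' (w $ 3))}" (is "open ?N")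
    by (rule open_off_centres[OF _ chart_cases[OF c] cont]) auto
  moreover have "?N = {w. w $ 3 \<in> B \<and> (P w \<longrightarrow> (w $ 3, \<psi> (a (w $ 3) + f w) (b (w $ 3) + g w)) \<notin> centres C)}"
    (is "_ = ?M")
  proof (intro equalityI subsetI)
    fix w assume w: "w \<in> ?N"
    then have "\<psi> (a (w $ 3) + f w) (b (w $ 3) + g w) \<noteq> \<psi> (a (w $ 3)) (b (w $ 3))" if "P w"
      using that chart_inject[OF c] P by auto
    then show "w \<in> ?M" using w by (fastforce simp: in_centres)
  next
    fix w assume w: "w \<in> ?M"
    show "w \<in> ?N"
    proof (cases "P w")
      case True
      then show ?thesis using w by (fastforce simp: in_centres)
    next
      case False
      then have "f w = 0" "g w = 0" using P by auto
      then show ?thesis using w disjoint_curves[OF c] by fastforce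
    qed
  qed
  ultimately show ?thesis by simp
qed

text \<open>These are the equations of the strict transforms in the chart (x, y/x, q). Over the
  first two kinds of curve the ruling becomes the exceptional divisor times a part invisible in this
  chart, and at \<open>w $ 1 = 0\<close> the remaining inequality is the one in the hypothesis. In
  the third case the equation of the surface acquires a factor \<open>w $ 1\<close>, which is
  divided out.\<close>

lemma family_kept_exc1:
  assumes w: "w $ 3 \<in> B"
  defines "q \<equiv> w $ 3"
  shows "\<psi> = uv \<Longrightarrow> \<forall>q\<in>B. a q = 0 \<and> t \<noteq> (1 - q) * b q \<Longrightarrow>
      exc_param1 \<psi> a b w \<in> family_kept t \<longleftrightarrow> (w $ 1 - 1) * (w $ 1 - t) \<noteq> (1 - q) * (b q + w $ 1 * w $ 2)"
    and "\<psi> = uv2 \<Longrightarrow> \<forall>q\<in>B. a q = 0 \<and> 1 \<noteq> (1 - q) * b q \<Longrightarrow>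
      exc_param1 \<psi> a b w \<in> family_kept t \<longleftrightarrow> (1 - w $ 1) * (1 - t * w $ 1) \<noteq> (1 - q) * (b q + w $ 1 * w $ 2)"
    and "\<psi> = uv \<Longrightarrow> \<forall>q\<in>B. a q \<noteq> 0 \<and> (a q - 1) * (a q - t) = (1 - q) * b q \<Longrightarrow>
      exc_param1 \<psi> a b w \<in> family_kept t \<longleftrightarrow> a q + w $ 1 \<noteq> 0 \<and> 2 * a q - 1 - t + w $ 1 \<noteq> (1 - q) * w $ 2"
proof -
  assume "\<psi> = uv" "\<forall>q\<in>B. a q = 0 \<and> t \<noteq> (1 - q) * b q"
  then show "exc_param1 \<psi> a b w \<in> family_kept t \<longleftrightarrow> (w $ 1 - 1) * (w $ 1 - t) \<noteq> (1 - q) * (b q + w $ 1 * w $ 2)"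
    using w by (cases "w $ 1 = 0") (auto simp: exc_param1_def family_kept_def kept_Exc_uv kept_Off_uv q_def)
next
  assume "\<psi> = uv2" "\<forall>q\<in>B. a q = 0 \<and> 1 \<noteq> (1 - q) * b q"
  then show "exc_param1 \<psi> a b w \<in> family_kept t \<longleftrightarrow> (1 - w $ 1) * (1 - t * w $ 1) \<noteq> (1 - q) * (b q + w $ 1 * w $ 2)"
    using w by (cases "w $ 1 = 0") (auto simp: exc_param1_def family_kept_def kept_Exc_uv2 kept_Off_uv2 q_def)
next
  assume \<psi>: "\<psi> = uv" and "\<forall>q\<in>B. a q \<noteq> 0 \<and> (a q - 1) * (a q - t) = (1 - q) * b q"
  then have a: "a q \<noteq> 0" "(a q - 1) * (a q - t) = (1 - q) * b q" using w by (auto simp: q_def)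
  \<comment> \<open>Expansion at the centre. The constant part vanishes because the centre lies on
    the surface, and the rest is divisible by the equation of the exceptional divisor.\<close>
  have "(a q + w $ 1 - 1) * (a q + w $ 1 - t) - (1 - q) * (b q + w $ 1 * w $ 2) =
    (a q - 1) * (a q - t) - (1 - q) * b q + w $ 1 * (2 * a q - 1 - t + w $ 1 - (1 - q) * w $ 2)"
    by algebra
  also have "\<dots> = w $ 1 * (2 * a q - 1 - t + w $ 1 - (1 - q) * w $ 2)" using a by simp
  finally have "w $ 1 \<noteq> 0 \<Longrightarrow> (a q + w $ 1 - 1) * (a q + w $ 1 - t) = (1 - q) * (b q + w $ 1 * w $ 2) \<longleftrightarrow>
    2 * a q - 1 - t + w $ 1 = (1 - q) * w $ 2"
    by (metis eq_iff_diff_eq_0 mult_eq_0_iff)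
  then show "exc_param1 \<psi> a b w \<in> family_kept t \<longleftrightarrow> a q + w $ 1 \<noteq> 0 \<and> 2 * a q - 1 - t + w $ 1 \<noteq> (1 - q) * w $ 2"
    using a \<psi> by (cases "w $ 1 = 0") (auto simp: exc_param1_def family_kept_def kept_Exc_uv kept_Off_uv q_def[symmetric])
qed

text \<open>In this chart the ruling carrying a curve of the first two kinds has strict transform
  \<open>w $ 1 = 0\<close>. In the third case the equation at \<open>w $ 1 = 0\<close>,
  \<open>w $ 2 = 0\<close> becomes 1 - q = 0, so the vertical direction is discarded exactly at q =
  1.\<close>

lemma family_kept_exc2:
  assumes w: "w $ 3 \<in> B"
  defines "q \<equiv> w $ 3"
  shows "\<psi> = uv \<Longrightarrow> \<forall>q\<in>B. a q = 0 \<and> t \<noteq> (1 - q) * b q \<Longrightarrow>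
      exc_param2 \<psi> a b w \<in> family_kept t \<longleftrightarrow>
        w $ 1 \<noteq> 0 \<and> (w $ 1 * w $ 2 - 1) * (w $ 1 * w $ 2 - t) \<noteq> (1 - q) * (b q + w $ 2)"
    and "\<psi> = uv2 \<Longrightarrow> \<forall>q\<in>B. a q = 0 \<and> 1 \<noteq> (1 - q) * b q \<Longrightarrow>
      exc_param2 \<psi> a b w \<in> family_kept t \<longleftrightarrow>
        w $ 1 \<noteq> 0 \<and> (1 - w $ 1 * w $ 2) * (1 - t * (w $ 1 * w $ 2)) \<noteq> (1 - q) * (b q + w $ 2)"
    and "\<psi> = uv \<Longrightarrow> \<forall>q\<in>B. a q \<noteq> 0 \<and> (a q - 1) * (a q - t) = (1 - q) * b q \<Longrightarrow>
      exc_param2 \<psi> a b w \<in> family_kept t \<longleftrightarrow>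
        a q + w $ 1 * w $ 2 \<noteq> 0 \<and> w $ 1 * (2 * a q - 1 - t + w $ 1 * w $ 2) \<noteq> 1 - q"
proof -
  assume "\<psi> = uv" "\<forall>q\<in>B. a q = 0 \<and> t \<noteq> (1 - q) * b q"
  then show "exc_param2 \<psi> a b w \<in> family_kept t \<longleftrightarrow>
        w $ 1 \<noteq> 0 \<and> (w $ 1 * w $ 2 - 1) * (w $ 1 * w $ 2 - t) \<noteq> (1 - q) * (b q + w $ 2)"
    using w by (cases "w $ 2 = 0") (auto simp: exc_param2_def family_kept_def kept_Exc_uv kept_Off_uv q_def)
next
  assume "\<psi> = uv2" "\<forall>q\<in>B. a q = 0 \<and> 1 \<noteq> (1 - q) * b q"
  then show "exc_param2 \<psi> a b w \<in> family_kept t \<longleftrightarrow>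
        w $ 1 \<noteq> 0 \<and> (1 - w $ 1 * w $ 2) * (1 - t * (w $ 1 * w $ 2)) \<noteq> (1 - q) * (b q + w $ 2)"
    using w by (cases "w $ 2 = 0") (auto simp: exc_param2_def family_kept_def kept_Exc_uv2 kept_Off_uv2 q_def)
next
  assume \<psi>: "\<psi> = uv" and "\<forall>q\<in>B. a q \<noteq> 0 \<and> (a q - 1) * (a q - t) = (1 - q) * b q"
  then have a: "a q \<noteq> 0" "(a q - 1) * (a q - t) = (1 - q) * b q" using w by (auto simp: q_def)
  have "(a q + w $ 1 * w $ 2 - 1) * (a q + w $ 1 * w $ 2 - t) - (1 - q) * (b q + w $ 2) =
    (a q - 1) * (a q - t) - (1 - q) * b q + w $ 2 * (w $ 1 * (2 * a q - 1 - t + w $ 1 * w $ 2) - (1 - q))"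
    by algebra
  also have "\<dots> = w $ 2 * (w $ 1 * (2 * a q - 1 - t + w $ 1 * w $ 2) - (1 - q))" using a by simp
  finally have *: "w $ 2 \<noteq> 0 \<Longrightarrow> (a q + w $ 1 * w $ 2 - 1) * (a q + w $ 1 * w $ 2 - t) = (1 - q) * (b q + w $ 2) \<longleftrightarrow>
    w $ 1 * (2 * a q - 1 - t + w $ 1 * w $ 2) = 1 - q"
    by (metis eq_iff_diff_eq_0 mult_eq_0_iff)
  \<comment> \<open>On the exceptional divisor the direction has slope 1 / \<open>w $ 1\<close>;
    clearing this denominator joins the cases of finite and infinite slope into one polynomial
    condition.\<close>
  have "w $ 1 \<noteq> 0 \<Longrightarrow> (1 - q) * (1 / w $ 1) = 2 * a q - 1 - t \<longleftrightarrow> w $ 1 * (2 * a q - 1 - t) = 1 - q"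
    by (auto simp: field_simps)
  then show "exc_param2 \<psi> a b w \<in> family_kept t \<longleftrightarrow>
        a q + w $ 1 * w $ 2 \<noteq> 0 \<and> w $ 1 * (2 * a q - 1 - t + w $ 1 * w $ 2) \<noteq> 1 - q"
    using a \<psi> * by (cases "w $ 2 = 0"; cases "w $ 1 = 0")
      (auto simp: exc_param2_def family_kept_def kept_Exc_uv kept_Off_uv q_def[symmetric])
qed

lemma open_family_kept_exc:
  assumes c: "(\<psi>, a, b) \<in> L"
  shows "open {w \<in> over_base. exc_param1 \<psi> a b w \<in> family_kept t}"
    and "open {w \<in> over_base. exc_param2 \<psi> a b w \<in> family_kept t}"
proof -
  note k1 = family_kept_exc1 and k2 = family_kept_exc2
  note cont = continuous_on_curve[OF c]
  have "open {w \<in> over_base. exc_param1 \<psi> a b w \<in> family_kept t} \<and>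
    open {w \<in> over_base. exc_param2 \<psi> a b w \<in> family_kept t}"
    using curve_cases[OF c]
  proof (elim disjE conjE)
    assume h: "\<psi> = uv" "\<forall>q\<in>B. a q = 0 \<and> t \<noteq> (1 - q) * b q"
    have "open {w \<in> over_base. (w $ 1 - 1) * (w $ 1 - t) \<noteq> (1 - w $ 3) * (b (w $ 3) + w $ 1 * w $ 2)}"
      "open {w \<in> over_base. w $ 1 \<noteq> 0 \<and>
        (w $ 1 * w $ 2 - 1) * (w $ 1 * w $ 2 - t) \<noteq> (1 - w $ 3) * (b (w $ 3) + w $ 2)}"
      by (intro open_Collect_Int open_neq open_over_base continuous_intros cont)+
    then show ?thesis using k1(1)[OF _ h] k2(1)[OF _ h] by (simp cong: conj_cong)
  next
    assume h: "\<psi> = uv2" "\<forall>q\<in>B. a q = 0 \<and> 1 \<noteq> (1 - q) * b q"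
    have "open {w \<in> over_base. (1 - w $ 1) * (1 - t * w $ 1) \<noteq> (1 - w $ 3) * (b (w $ 3) + w $ 1 * w $ 2)}"
      "open {w \<in> over_base. w $ 1 \<noteq> 0 \<and>
        (1 - w $ 1 * w $ 2) * (1 - t * (w $ 1 * w $ 2)) \<noteq> (1 - w $ 3) * (b (w $ 3) + w $ 2)}"
      by (intro open_Collect_Int open_neq open_over_base continuous_intros cont)+
    then show ?thesis using k1(2)[OF _ h] k2(2)[OF _ h] by (simp cong: conj_cong)
  next
    assume h: "\<psi> = uv" "\<forall>q\<in>B. a q \<noteq> 0 \<and> (a q - 1) * (a q - t) = (1 - q) * b q"
    have "open {w \<in> over_base. a (w $ 3) + w $ 1 \<noteq> 0 \<and> 2 * a (w $ 3) - 1 - t + w $ 1 \<noteq> (1 - w $ 3) * w $ 2}"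
      "open {w \<in> over_base. a (w $ 3) + w $ 1 * w $ 2 \<noteq> 0 \<and>
        w $ 1 * (2 * a (w $ 3) - 1 - t + w $ 1 * w $ 2) \<noteq> 1 - w $ 3}"
      by (intro open_Collect_Int open_neq open_over_base continuous_intros cont)+
    then show ?thesis using k1(3)[OF _ h] k2(3)[OF _ h] by (simp cong: conj_cong)
  qed
  then show "open {w \<in> over_base. exc_param1 \<psi> a b w \<in> family_kept t}"
    "open {w \<in> over_base. exc_param2 \<psi> a b w \<in> family_kept t}" by auto
qed


text \<open>Openness is claimed in one suitable chart at each point. Intersecting that chart with
  the explicit set then gives a neighbourhood in the atlas topology and an open set of coordinates
  at the same time.\<close>

lemma family_kept_chart:
  assumes z: "z \<in> points X" "z \<in> family_kept t"
  obtains U \<phi> where "(U, \<phi>) \<in> X" "z \<in> U" "inj_on \<phi> U" "open (\<phi> ` (U \<inter> family_kept t))"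
proof -
  note found = that
  have chart: thesis if c: "c \<in> X" "z \<in> fst c" "chart_param c D \<iota>" and D: "open D"
    and K: "open {w \<in> over_base. \<iota> w \<in> family_kept t}" and DB: "D \<subseteq> over_base" for c D \<iota>
  proof (rule found)
    show "(fst c, snd c) \<in> X" "z \<in> fst c" using c by auto
    show "inj_on (snd c) (fst c)" using c(3) by (intro inj_on_inverseI) (auto simp: chart_param_def)
    have "snd c ` (fst c \<inter> family_kept t) = D \<inter> {w \<in> over_base. \<iota> w \<in> family_kept t}"
      using c(3) DB by (force simp: chart_param_def)
    then show "open (snd c ` (fst c \<inter> family_kept t))" using open_Int[OF D K] by simp
  qed
  consider q p where "z = Off (q, p)" "q \<in> B" "(q, p) \<notin> centres C"
    | q \<psi> a b l where "z = Exc (q, \<psi> (a q) (b q)) l" "q \<in> B" "(\<psi>, a, b) \<in> L"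
    using z(1) unfolding points_blowup_family by (force simp: in_centres)
  then show thesis
  proof cases
    case 1
    \<comment> \<open>A surviving point off the centres has finite coordinates, so the chart
      \<open>uv\<close> serves for all of them.\<close>
    then obtain u v where p: "p = uv u v"
      using z(2) by (auto simp: family_kept_def kept.simps)
    let ?U = "B \<times> param_dom uv" and ?\<phi> = "\<lambda>(q, p). vector [param_inv uv p $ 1, param_inv uv p $ 2, q] :: complex^3"
    have "(?U, ?\<phi>) \<in> times_atlas B F2" by (force simp: times_atlas_def F2_def)
    then have mem: "(Off ` (?U - centres C), ?\<phi> \<circ> down) \<in> X" unfolding blowup_def by blast
    have D: "{w :: complex^3. w $ 3 \<in> B \<and> (w $ 3, uv (w $ 1) (w $ 2)) \<notin> centres C} =
      {w \<in> over_base. \<forall>(\<psi>', a', b')\<in>L. uv (w $ 1) (w $ 2) \<noteq> \<psi>' (a' (w $ 3)) (b' (w $ 3))}"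
      by (auto simp: in_centres)
    have "open {w \<in> over_base. w $ 1 \<noteq> 0 \<and> (w $ 1 - 1) * (w $ 1 - t) \<noteq> (1 - w $ 3) * w $ 2}"
      by (intro open_Collect_Int open_neq open_over_base continuous_intros)
    then have K: "open {w \<in> over_base. Off (w $ 3, uv (w $ 1) (w $ 2)) \<in> family_kept t}"
      by (simp add: family_kept_def kept_Off_uv)
    show thesis
    proof (rule chart[OF mem _ off_chart_param _ K])
      show "z \<in> fst (Off ` (?U - centres C), ?\<phi> \<circ> down)" using 1 p by (auto simp: param_dom_def)
      show "open {w :: complex^3. w $ 3 \<in> B \<and> (w $ 3, uv (w $ 1) (w $ 2)) \<notin> centres C}"
        unfolding D by (rule open_off_centres) (auto intro!: continuous_intros)
    qed auto
  next
    case 2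
    note \<psi> = param_inv_curve[OF 2(3)]
    have cen: "(q, \<psi> (a q) (b q)) \<in> centre (curve_centre B (\<psi>, a, b))"
      using 2(2) in_centre_curve_centre[OF \<psi>] by simp
    have mem: "exc_chart1 C (curve_centre B (\<psi>, a, b)) \<in> X" "exc_chart2 C (curve_centre B (\<psi>, a, b)) \<in> X"
      using 2(3) unfolding blowup_def by blast+
    show thesis
    proof (cases l)
      case None
      show thesis
      proof (rule chart[OF mem(2) _ exc_chart2_param[OF \<psi>] _ open_family_kept_exc(2)[OF 2(3)]])
        show "z \<in> fst (exc_chart2 C (curve_centre B (\<psi>, a, b)))"
          using 2(1) None cen by (cases "curve_centre B (\<psi>, a, b)") (auto simp: exc_chart2_def simp del: split_paired_Ex)
        show "open {w :: complex^3. w $ 3 \<in> B \<and> (w $ 2 \<noteq> 0 \<longrightarrow>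
          (w $ 3, \<psi> (a (w $ 3) + w $ 1 * w $ 2) (b (w $ 3) + w $ 2)) \<notin> centres C)}"
          by (rule open_exc_domain[OF 2(3), where f = "\<lambda>w. w $ 1 * w $ 2" and g = "\<lambda>w. w $ 2"
                and P = "\<lambda>w. w $ 2 \<noteq> 0"]) (auto intro!: continuous_intros)
      qed auto
    next
      case (Some s)
      show thesis
      proof (rule chart[OF mem(1) _ exc_chart1_param[OF \<psi>] _ open_family_kept_exc(1)[OF 2(3)]])
        show "z \<in> fst (exc_chart1 C (curve_centre B (\<psi>, a, b)))"
          using 2(1) Some cen by (cases "curve_centre B (\<psi>, a, b)") (auto simp: exc_chart1_def simp del: split_paired_Ex)
        show "open {w :: complex^3. w $ 3 \<in> B \<and> (w $ 1 \<noteq> 0 \<longrightarrow>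
          (w $ 3, \<psi> (a (w $ 3) + w $ 1) (b (w $ 3) + w $ 1 * w $ 2)) \<notin> centres C)}"
          by (rule open_exc_domain[OF 2(3), where f = "\<lambda>w. w $ 1" and g = "\<lambda>w. w $ 1 * w $ 2"
                and P = "\<lambda>w. w $ 1 \<noteq> 0"]) (auto intro!: continuous_intros)
      qed auto
    qed
  qed
qed

end


section \<open>Closures in the blow-up\<close>

lemma map_blown_Pair_snd: "fst (down z) = q \<Longrightarrow> map_blown (Pair q) (map_blown snd z) = z"
  by (cases z) auto

lemma map_blown_snd_Pair [simp]: "map_blown snd (map_blown (Pair q) z) = z"
  by (cases z) auto

lemma fst_down_Pair [simp]: "fst (down (map_blown (Pair q) z)) = q"
  by (cases z) auto

lemma down_map_blown [simp]: "down (map_blown f z) = f (down z)"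
  by (cases z) auto

lemma points_remove_closed [simp]: "points (remove_closed A R) = points A - R"
  by (auto simp: points_def remove_closed_def)

lemma Off_in_strict_transform:
  assumes "p \<in> S" "Off p \<in> points (blowup A C)" "p \<notin> centres C"
  shows "Off p \<in> strict_transform A C S"
  unfolding strict_transform_def in_closure_of topspace_atlas using assms by blast

lemma strict_transform_subset_points: "strict_transform A C S \<subseteq> points (blowup A C)"
  unfolding strict_transform_def topspace_atlas[symmetric] by (rule closure_of_subset_topspace)

lemma F2_uv_chart: "(param_dom uv, param_inv uv) \<in> F2"
  by (simp add: F2_def)

text \<open>The failure of a polynomial equation is an open condition in the chart, so the closure
  adds points only outside this chart.\<close>

lemma surface_C_uv:
  assumes "(q, uv u v) \<in> surface_C t" shows "(u - 1) * (u - t) = (1 - q) * v"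
proof (rule ccontr)
  assume ne: "(u - 1) * (u - t) \<noteq> (1 - q) * v"
  let ?A = "times_atlas (- {0}) F2" and ?N = "{w :: complex^3. (w $ 1 - 1) * (w $ 1 - t) \<noteq> (1 - w $ 3) * w $ 2}"
  let ?\<phi> = "\<lambda>(q, p). vector [param_inv uv p $ 1, param_inv uv p $ 2, q] :: complex^3"
  have "((- {0}) \<times> param_dom uv, ?\<phi>) \<in> ?A" using F2_uv_chart by (force simp: times_atlas_def)
  moreover have "open ?N" by (intro open_Collect_neq continuous_intros)
  ultimately have op: "openin (atlas_topology ?A) {p \<in> (- {0}) \<times> param_dom uv. ?\<phi> p \<in> ?N}"
    by (rule openin_atlas_chart)
  have cl: "(q, uv u v) \<in> points ?A" "\<forall>T. (q, uv u v) \<in> T \<and> openin (atlas_topology ?A) T \<longrightarrow>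
      (\<exists>y. y \<in> {(q, uv u v) | q u v. q \<noteq> 0 \<and> (u - 1) * (u - t) = (1 - q) * v} \<and> y \<in> T)"
    using assms unfolding surface_C_def in_closure_of topspace_atlas by (rule conjunct1, rule conjunct2)
  have mem: "(q, uv u v) \<in> {p \<in> (- {0}) \<times> param_dom uv. ?\<phi> p \<in> ?N}"
    using ne cl(1) by (auto simp: points_times_atlas param_dom_def)
  then obtain y where y: "y \<in> {(q, uv u v) | q u v. q \<noteq> 0 \<and> (u - 1) * (u - t) = (1 - q) * v}"
    "?\<phi> y \<in> ?N" using cl(2)[rule_format, OF conjI[OF mem op]] by (elim exE conjE CollectE) simp
  then obtain q' u' v' where "y = (q', uv u' v')" "(u' - 1) * (u' - t) = (1 - q') * v'" by blast
  then show False using y(2) by simp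
qed

lemma curve_Cq_uv:
  assumes "uv u v \<in> curve_Cq q t" shows "(u - 1) * (u - t) = (1 - q) * v"
proof (rule ccontr)
  assume ne: "(u - 1) * (u - t) \<noteq> (1 - q) * v"
  let ?N = "{w :: complex^2. (w $ 1 - 1) * (w $ 1 - t) \<noteq> (1 - q) * w $ 2}"
  have "open ?N" by (intro open_Collect_neq continuous_intros)
  then have op: "openin (atlas_topology F2) {p \<in> param_dom uv. param_inv uv p \<in> ?N}"
    by (rule openin_atlas_chart[OF F2_uv_chart])
  have cl: "\<forall>T. uv u v \<in> T \<and> openin (atlas_topology F2) T \<longrightarrow>
      (\<exists>y. y \<in> {uv u v | u v. (u - 1) * (u - t) = (1 - q) * v} \<and> y \<in> T)"
    using assms unfolding curve_Cq_def in_closure_of by (rule conjunct2)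
  have mem: "uv u v \<in> {p \<in> param_dom uv. param_inv uv p \<in> ?N}"
    using ne by (auto simp: param_dom_def)
  then obtain y where y: "y \<in> {uv u v | u v. (u - 1) * (u - t) = (1 - q) * v}"
    "param_inv uv y \<in> ?N" using cl[rule_format, OF conjI[OF mem op]] by (elim exE conjE CollectE) simp
  then obtain u' v' where "y = uv u' v'" "(u' - 1) * (u' - t) = (1 - q) * v'" by blast
  then show False using y(2) by simp
qed

text \<open>The property of containing the sequence eventually, given that z belongs to the set,
  passes to finite intersections and arbitrary unions. Convergence to z is thus tested on the chart
  sets containing z, without knowing that those of one chart form a neighbourhood basis.\<close>

lemma eventually_topology_generated_by:
  assumes "openin (topology_generated_by S) T" "z \<in> T"
    and basis: "\<And>W. W \<in> S \<Longrightarrow> z \<in> W \<Longrightarrow> \<forall>\<^sub>F n in F. f n \<in> W"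
  shows "\<forall>\<^sub>F n in F. f n \<in> T"
proof -
  from assms(1) have "generate_topology_on S T" by (simp add: openin_topology_generated_by)
  then have "z \<in> T \<longrightarrow> (\<forall>\<^sub>F n in F. f n \<in> T)"
  proof induction
    case (Int a b)
    then show ?case by (auto intro: eventually_conj)
  next
    case (UN K)
    show ?case
    proof
      assume "z \<in> \<Union> K"
      then obtain k where "k \<in> K" "z \<in> k" by blast
      then have "\<forall>\<^sub>F n in F. f n \<in> k" using UN by blast
      then show "\<forall>\<^sub>F n in F. f n \<in> \<Union> K" using \<open>k \<in> K\<close> by (auto elim!: eventually_mono)
    qed
  qed (use basis in auto)
  then show ?thesis using assms(2) by blast
qed

text \<open>A sequence in \<open>S\<close> tending to the centre with limiting direction
  \<open>l\<close> converges to the corresponding exceptional point. Since every chart contributes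
  open sets, convergence is checked in both exceptional charts that may contain the point:
  \<open>one\<close> handles finite directions, \<open>two\<close> those different from slope 0. The
  hypothesis \<open>uniq\<close> ensures that no other centre supplies a chart there.\<close>

lemma Exc_in_strict_transform_sequence:
  fixes A :: "(hirz, 2) atlas" and \<psi> a b
  defines "c \<equiv> point_centre (\<psi>, a, b)"
  assumes \<psi>: "\<And>u v. param_inv \<psi> (\<psi> u v) = vector [u, v]" and c: "c \<in> D"
    and uniq: "\<And>d. d \<in> D \<Longrightarrow> \<psi> a b \<in> centre d \<Longrightarrow> d = c"
    and S: "\<forall>\<^sub>F n in sequentially. \<psi> (a + x n) (b + y n) \<in> S - centres D"
    and one: "\<And>s. l = Some s \<Longrightarrow> (\<forall>\<^sub>F n in sequentially. x n \<noteq> 0) \<and> x \<longlonglongrightarrow> 0 \<and> (\<lambda>n. y n / x n) \<longlonglongrightarrow> s"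
    and two: "l \<noteq> Some 0 \<Longrightarrow> (\<forall>\<^sub>F n in sequentially. y n \<noteq> 0) \<and> y \<longlonglongrightarrow> 0 \<and>
      (\<lambda>n. x n / y n) \<longlonglongrightarrow> (case l of None \<Rightarrow> 0 | Some s \<Rightarrow> 1 / s)"
  shows "Exc (\<psi> a b) l \<in> strict_transform A D S"
proof -
  let ?p = "\<lambda>n. \<psi> (a + x n) (b + y n)" and ?z = "Exc (\<psi> a b) l"
  have cen: "\<psi> a b \<in> centre c"
    by (auto simp: c_def centre_def point_centre_def param_dom_def \<psi>)
  have chart1: "\<forall>\<^sub>F n in sequentially. Off (?p n) \<in> {z \<in> fst (exc_chart1 D d). snd (exc_chart1 D d) z \<in> N}"
    if d: "d \<in> D" "?z \<in> fst (exc_chart1 D d)" "snd (exc_chart1 D d) ?z \<in> N" "open N" for d N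
  proof -
    have "\<psi> a b \<in> centre d" using d(2) by (cases d) (auto simp: exc_chart1_def)
    then have dc: "d = c" using uniq d(1) by blast
    obtain s where s: "l = Some s" using d(2) by (cases d) (auto simp: exc_chart1_def)
    have coord: "snd (exc_chart1 D d) (Off (?p n)) = vector [x n, y n / x n]" for n
      by (simp add: dc c_def exc_chart1_def point_centre_def \<psi> vec_eq_iff forall_2)
    have "snd (exc_chart1 D d) ?z = vector [0, s]"
      by (simp add: s dc c_def exc_chart1_def point_centre_def \<psi> vec_eq_iff forall_2)
    moreover have "(\<lambda>n. vector [x n, y n / x n] :: complex^2) \<longlonglongrightarrow> vector [0, s]"
    proof (rule vec_tendstoI)
      fix i :: 2 show "(\<lambda>n. (vector [x n, y n / x n] :: complex^2) $ i) \<longlonglongrightarrow> vector [0, s] $ i"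
        using exhaust_2[of i] one[OF s] by auto
    qed
    ultimately have "\<forall>\<^sub>F n in sequentially. snd (exc_chart1 D d) (Off (?p n)) \<in> N"
      unfolding coord using d(3,4) by (simp add: topological_tendstoD)
    moreover have "\<forall>\<^sub>F n in sequentially. Off (?p n) \<in> fst (exc_chart1 D d)"
      using S conjunct1[OF one[OF s]]
      by eventually_elim (auto simp: dc c_def exc_chart1_def point_centre_def param_dom_def \<psi> simp del: split_paired_Ex)
    ultimately show ?thesis by eventually_elim simp
  qed
  have chart2: "\<forall>\<^sub>F n in sequentially. Off (?p n) \<in> {z \<in> fst (exc_chart2 D d). snd (exc_chart2 D d) z \<in> N}"
    if d: "d \<in> D" "?z \<in> fst (exc_chart2 D d)" "snd (exc_chart2 D d) ?z \<in> N" "open N" for d N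
  proof -
    have "\<psi> a b \<in> centre d" using d(2) by (cases d) (auto simp: exc_chart2_def)
    then have dc: "d = c" using uniq d(1) by blast
    have l: "l \<noteq> Some 0" using d(2) by (cases d) (auto simp: exc_chart2_def)
    define r where "r = (case l of None \<Rightarrow> 0 | Some s \<Rightarrow> 1 / s)"
    have coord: "snd (exc_chart2 D d) (Off (?p n)) = vector [x n / y n, y n]" for n
      by (simp add: dc c_def exc_chart2_def point_centre_def \<psi> vec_eq_iff forall_2)
    have "snd (exc_chart2 D d) ?z = vector [r, 0]"
      by (simp add: r_def dc c_def exc_chart2_def point_centre_def \<psi> vec_eq_iff forall_2)
    moreover have "(\<lambda>n. vector [x n / y n, y n] :: complex^2) \<longlonglongrightarrow> vector [r, 0]"
    proof (rule vec_tendstoI)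
      fix i :: 2 show "(\<lambda>n. (vector [x n / y n, y n] :: complex^2) $ i) \<longlonglongrightarrow> vector [r, 0] $ i"
        using exhaust_2[of i] two[OF l] by (auto simp: r_def)
    qed
    ultimately have "\<forall>\<^sub>F n in sequentially. snd (exc_chart2 D d) (Off (?p n)) \<in> N"
      unfolding coord using d(3,4) by (simp add: topological_tendstoD)
    moreover have "\<forall>\<^sub>F n in sequentially. Off (?p n) \<in> fst (exc_chart2 D d)"
      using S conjunct1[OF two[OF l]]
      by eventually_elim (auto simp: dc c_def exc_chart2_def point_centre_def param_dom_def \<psi> simp del: split_paired_Ex)
    ultimately show ?thesis by eventually_elim simp
  qed
  have "?z \<in> points (blowup A D)"
  proof (cases l)
    case None
    then have "?z \<in> fst (exc_chart2 D c)" using cen by (cases c) (auto simp: exc_chart2_def simp del: split_paired_Ex)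
    then show ?thesis using c by (auto simp: points_def blowup_def split_beta)
  next
    case (Some s)
    then have "?z \<in> fst (exc_chart1 D c)" using cen by (cases c) (auto simp: exc_chart1_def simp del: split_paired_Ex)
    then show ?thesis using c by (auto simp: points_def blowup_def split_beta)
  qed
  moreover have "\<exists>z. z \<in> Off ` (S - centres D) \<and> z \<in> T"
    if T: "?z \<in> T" "openin (atlas_topology (blowup A D)) T" for T
  proof -
    have "\<forall>\<^sub>F n in sequentially. Off (?p n) \<in> T"
    proof (rule eventually_topology_generated_by[OF T(2)[unfolded atlas_topology_def] T(1)])
      fix W assume "W \<in> {W. \<exists>(U, \<phi>)\<in>blowup A D. \<exists>O'. open O' \<and> W = {p \<in> U. \<phi> p \<in> O'}}" and z: "?z \<in> W"
      then obtain e N where e: "e \<in> blowup A D" "open N" "W = {p \<in> fst e. snd e p \<in> N}" by auto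
      \<comment> \<open>Charts of the third sort consist of points \<open>Off p\<close> and cannot
        contain an exceptional point.\<close>
      with z consider d where "d \<in> D" "e = exc_chart1 D d" | d where "d \<in> D" "e = exc_chart2 D d"
        by (auto simp: blowup_def)
      then show "\<forall>\<^sub>F n in sequentially. Off (?p n) \<in> W"
        by cases (use chart1 chart2 e z in auto)
    qed
    then have "\<forall>\<^sub>F n in sequentially. Off (?p n) \<in> T \<and> ?p n \<in> S - centres D"
      using S by (rule eventually_conj)
    then obtain n where "Off (?p n) \<in> T" "?p n \<in> S - centres D"
      using eventually_happens'[OF sequentially_bot] by blast
    then show ?thesis by blast
  qed
  ultimately show ?thesis
    unfolding strict_transform_def in_closure_of topspace_atlas by blast
qed

section \<open>The discarded sets over one value of q\<close>

context marked_family
begin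

definition removed :: "(complex \<times> hirz) blown set" where
  "removed = strict_transform (times_atlas B F2) C (B \<times> curve_H) \<union>
     strict_transform (times_atlas B F2) C (surface_C t \<inter> B \<times> UNIV) \<union>
     strict_transform (times_atlas B F2) C (B \<times> curve_D 0) \<union>
     strict_transform (times_atlas B F2) C (B \<times> curve_D_inf)"

text \<open>A point of the closure that survived would have a neighbourhood consisting of surviving
  points, and this neighbourhood would have to meet \<open>S\<close> off the centres.\<close>

lemma strict_transform_not_kept:
  assumes "\<And>x. x \<in> S \<Longrightarrow> Off x \<notin> family_kept t"
  shows "strict_transform (times_atlas B F2) C S \<inter> family_kept t = {}"
proof (rule ccontr)
  assume "\<not> ?thesis"
  then obtain z where z: "z \<in> strict_transform (times_atlas B F2) C S" "z \<in> family_kept t" by blast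
  have "z \<in> points X" using z(1) strict_transform_subset_points by blast
  then obtain U \<phi> where c: "(U, \<phi>) \<in> X" "z \<in> U" "inj_on \<phi> U" "open (\<phi> ` (U \<inter> family_kept t))"
    using family_kept_chart z(2) by metis
  have "{x \<in> U. \<phi> x \<in> \<phi> ` (U \<inter> family_kept t)} = U \<inter> family_kept t"
    using c(3) by (auto simp: inj_on_def)
  then have op: "openin (atlas_topology X) (U \<inter> family_kept t)"
    using openin_atlas_chart[OF c(1,4)] by simp
  have cl: "\<forall>T. z \<in> T \<and> openin (atlas_topology X) T \<longrightarrow> (\<exists>y. y \<in> Off ` (S - centres C) \<and> y \<in> T)"
    using z(1) unfolding strict_transform_def in_closure_of by (rule conjunct2)
  have "\<exists>y. y \<in> Off ` (S - centres C) \<and> y \<in> U \<inter> family_kept t"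
    by (rule cl[rule_format]) (use c(2) z(2) op in blast)
  then show False using assms by auto
qed

lemma removed_not_kept: "removed \<inter> family_kept t = {}"
proof -
  have 1: "Off x \<notin> family_kept t" if "x \<in> B \<times> curve_H" for x
    using that by (auto simp: family_kept_def kept.simps curve_H_def uv_def uv1_def uv3_def split: if_splits)
  have 2: "Off x \<notin> family_kept t" if "x \<in> B \<times> curve_D 0" for x
    using that by (auto simp: family_kept_def kept.simps curve_D_def uv_def uv1_def split: if_splits)
  have 3: "Off x \<notin> family_kept t" if "x \<in> B \<times> curve_D_inf" for x
    using that by (auto simp: family_kept_def kept.simps curve_D_inf_def uv_def uv2_def uv3_def split: if_splits)
  have 4: "Off x \<notin> family_kept t" if "x \<in> surface_C t \<inter> B \<times> UNIV" for x
    using that surface_C_uv[of "fst x"] by (cases x) (auto simp: family_kept_def kept.simps)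
  show ?thesis
    unfolding removed_def Int_Un_distrib2 Un_empty by (intro conjI strict_transform_not_kept 1 2 3 4)
qed

text \<open>On the fibre, not surviving implies \<open>R\<close>, \<open>R\<close> implies
  \<open>removed\<close>, and \<open>removed\<close> excludes surviving, so the three descriptions
  agree. The open set required by \<open>biholomorphic_slice\<close> is then the coordinate image of
  the surviving points of one chart.\<close>

lemma fibre_is_of_kept:
  assumes q: "q \<in> B"
    and not_kept: "\<And>z. z \<in> points (blowup F2 (fibre_points q L)) \<Longrightarrow> \<not> kept t q z \<Longrightarrow> z \<in> R"
    and removed: "\<And>z. z \<in> points (blowup F2 (fibre_points q L)) \<Longrightarrow> z \<in> R \<Longrightarrow> map_blown (Pair q) z \<in> removed"
  shows "fibre_is (remove_closed X removed) q (remove_closed (blowup F2 (fibre_points q L)) R)"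
proof -
  let ?Y = "blowup F2 (fibre_points q L)" and ?e = "map_blown (Pair q)"
  let ?X' = "remove_closed X removed" and ?Y' = "remove_closed ?Y R"
  have family_kept: "?e z \<in> family_kept t \<longleftrightarrow> kept t q z" for z
    by (simp add: family_kept_def)
  have R: "?e z \<in> removed \<longleftrightarrow> z \<in> R" if "z \<in> points ?Y" for z
    using that not_kept removed removed_not_kept family_kept by blast
  have e_points: "?e z \<in> points ?X' \<longleftrightarrow> z \<in> points ?Y'" for z
    using points_blowup_slice[OF q] R by auto
  have fibre: "fibre ?X' q = ?e ` points ?Y'"
  proof (intro equalityI subsetI)
    fix x assume "x \<in> fibre ?X' q"
    then have "x \<in> points ?X'" "x = ?e (map_blown snd x)"
      by (auto simp: fibre_def map_blown_Pair_snd)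
    then show "x \<in> ?e ` points ?Y'" using e_points by (metis image_eqI)
  next
    fix x assume "x \<in> ?e ` points ?Y'"
    then show "x \<in> fibre ?X' q" using e_points by (auto simp: fibre_def)
  qed
  have "biholomorphic_between ?X' (?e ` points ?Y') ?Y' (points ?Y') (map_blown snd)"
  proof (rule biholomorphic_slice)
    fix y assume "y \<in> points ?Y'"
    then have y: "y \<in> points ?Y" "y \<notin> R" by auto
    have K: "?e y \<in> family_kept t" using y not_kept family_kept by blast
    have "?e y \<in> points X" using points_blowup_slice[OF q] y(1) by blast
    then obtain U \<phi> where c: "(U, \<phi>) \<in> X" "?e y \<in> U" "inj_on \<phi> U" "open (\<phi> ` (U \<inter> family_kept t))"
      using family_kept_chart K by metis
    obtain d where d: "d \<in> ?Y" "blown_slices_to q (U, \<phi>) d" using blowup_chart_slice[OF q c(1)] by metis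
    obtain V \<psi> where V: "d = (V, \<psi>)" by (cases d)
    have sl: "?e z \<in> U \<longleftrightarrow> z \<in> V" "z \<in> V \<Longrightarrow> \<phi> (?e z) = extend (\<psi> z) q"
      "x \<in> U \<Longrightarrow> \<phi> x $ 3 = fst (down x)" for z x
      using d(2) by (auto simp: blown_slices_to_def V)
    have VY: "V \<subseteq> points ?Y" using d(1) by (auto simp: V points_def)
    have inj: "inj_on \<psi> V"
    proof (rule inj_onI)
      fix z z' assume z: "z \<in> V" "z' \<in> V" "\<psi> z = \<psi> z'"
      then have "?e z = ?e z'" using inj_onD[OF c(3), of "?e z" "?e z'"] sl by simp
      then show "z = z'" by (metis map_blown_snd_Pair)
    qed
    show "\<exists>U \<phi> V \<psi> N. (U, \<phi>) \<in> ?X' \<and> (V, \<psi>) \<in> ?Y' \<and> y \<in> V \<and>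
      inj_on \<phi> U \<and> inj_on \<psi> V \<and> (\<forall>z\<in>V. ?e z \<in> U \<and> \<phi> (?e z) = extend (\<psi> z) q) \<and>
      (\<forall>z\<in>U. z \<in> ?e ` points ?Y' \<or> \<phi> z $ 3 = q \<longrightarrow> z \<in> ?e ` V) \<and> open N \<and> \<phi> (?e y) \<in> N \<and> N \<subseteq> \<phi> ` U"
    proof (intro exI conjI ballI impI)
      show "(U - removed, \<phi>) \<in> ?X'" using c(1) by (force simp: remove_closed_def)
      show "(V - R, \<psi>) \<in> ?Y'" using d(1) by (force simp: remove_closed_def V)
      show "y \<in> V - R" using y sl c(2) by blast
      show "inj_on \<phi> (U - removed)" "inj_on \<psi> (V - R)"
        using c(3) inj by (auto intro: inj_on_subset)
      show "open (\<phi> ` (U \<inter> family_kept t))" by (rule c(4))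
      show "\<phi> (?e y) \<in> \<phi> ` (U \<inter> family_kept t)" using c(2) K by blast
      show "\<phi> ` (U \<inter> family_kept t) \<subseteq> \<phi> ` (U - removed)" using removed_not_kept by blast
    next
      fix z assume "z \<in> V - R"
      then show "?e z \<in> U - removed" "\<phi> (?e z) = extend (\<psi> z) q" using sl VY R by blast+
    next
      fix z assume z: "z \<in> U - removed" "z \<in> ?e ` points ?Y' \<or> \<phi> z $ 3 = q"
      then have "fst (down z) = q" using sl(3)[of z] by auto
      then obtain z' where z': "z = ?e z'" using map_blown_Pair_snd by metis
      then have "z' \<in> V" using z(1) sl(1) by blast
      moreover from this have "z' \<notin> R" using z(1) VY R z' by blast
      ultimately show "z \<in> ?e ` (V - R)" using z' by blast
    qed
  qed simp
  then show ?thesis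
    unfolding fibre_is_def fibre by (intro exI[of _ "map_blown snd"]) simp
qed

lemma closedin_removed: "closedin (atlas_topology X) removed"
  unfolding removed_def strict_transform_def by (intro closedin_Un closedin_closure_of)

text \<open>\<open>removed\<close> is closed in the threefold, so its trace on the fibre is closed
  by continuity of the inclusion; a closed set containing \<open>S\<close> off the centres contains
  the strict transform.\<close>

lemma strict_transform_fibre_removed:
  assumes q: "q \<in> B" and S: "\<And>p. p \<in> S \<Longrightarrow> p \<notin> centres (fibre_points q L) \<Longrightarrow> Off (q, p) \<in> removed"
    and z: "z \<in> strict_transform F2 (fibre_points q L) S"
  shows "map_blown (Pair q) z \<in> removed"
proof (rule ccontr)
  assume n: "map_blown (Pair q) z \<notin> removed"
  let ?Y = "blowup F2 (fibre_points q L)"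
  have zY: "z \<in> points ?Y" using z strict_transform_subset_points by blast
  let ?W = "map_blown (Pair q) -` (points X - removed) \<inter> points ?Y"
  have "openin (atlas_topology X) (points X - removed)"
    using closedin_removed by (simp add: closedin_def topspace_atlas)
  then have op: "openin (atlas_topology ?Y) ?W" by (rule openin_vimage_fibre[OF q])
  have zW: "z \<in> ?W" using n zY points_blowup_slice[OF q] by blast
  have cl: "\<forall>T. z \<in> T \<and> openin (atlas_topology ?Y) T \<longrightarrow>
      (\<exists>y. y \<in> Off ` (S - centres (fibre_points q L)) \<and> y \<in> T)"
    using z unfolding strict_transform_def in_closure_of by (rule conjunct2)
  have "\<exists>y. y \<in> Off ` (S - centres (fibre_points q L)) \<and> y \<in> ?W"
    by (rule cl[rule_format]) (rule conjI[OF zW op])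
  then show False using S by auto
qed

lemma in_removed:
  assumes "q \<in> B" "p \<notin> centres (fibre_points q L)"
    and "p \<in> curve_H \<or> p \<in> curve_D 0 \<or> p \<in> curve_D_inf \<or> (q, p) \<in> surface_C t"
  shows "Off (q, p) \<in> removed"
proof -
  have n: "(q, p) \<notin> centres C" using assms centres_fibre_points by blast
  then have "Off (q, p) \<in> points X" using assms(1) by (auto simp: points_blowup_family)
  then show ?thesis
    using assms n unfolding removed_def by (auto intro: Off_in_strict_transform)
qed

lemma in_centres_fibre:
  assumes "q \<in> B"
  shows "p \<in> centres (fibre_points q L) \<longleftrightarrow> (\<exists>(\<psi>, a, b)\<in>L. p = \<psi> (a q) (b q))"
  using centres_fibre_points[OF assms, of p L] assms by (simp add: in_centres)

lemma finite_centres_fibre: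
  assumes "q \<in> B" shows "finite (centres (fibre_points q L))"
proof -
  have "centres (fibre_points q L) = (\<lambda>(\<psi>, a, b). \<psi> (a q) (b q)) ` L"
    using in_centres_fibre[OF assms] by (auto simp: split_beta image_iff)
  then show ?thesis using finite_curves by simp
qed

lemma centre_fibre_unique:
  assumes q: "q \<in> B" and c: "(\<psi>, a, b) \<in> L" and d: "d \<in> fibre_points q L" "\<psi> (a q) (b q) \<in> centre d"
  shows "d = point_centre (\<psi>, a q, b q)"
proof -
  obtain \<psi>' a' b' where d': "(\<psi>', a', b') \<in> L" "d = point_centre (\<psi>', a' q, b' q)"
    using d(1) by (auto simp: fibre_points_def)
  have "(q, \<psi> (a q) (b q)) \<in> centre (curve_centre B (\<psi>', a', b'))"
    using centre_slice[OF slices_to_curve_centre[OF q]] d(2) d'(2) by blast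
  then have "\<psi> (a q) (b q) = \<psi>' (a' q) (b' q)"
    using in_centre_curve_centre[OF param_inv_curve[OF d'(1)]] by blast
  then show ?thesis using disjoint_curves[OF c d'(1) q] d'(2) by simp
qed

text \<open>For a finite slope, control of x and y/x suffices: if the slope is nonzero, the
  conditions in the second chart follow from those in the first. The other centres are avoided
  eventually because there are finitely many.\<close>

lemma Exc_in_fibre_strict_transform:
  assumes q: "q \<in> B" and c: "(\<psi>, a, b) \<in> L"
    and S: "\<And>n. \<psi> (a q + x n) (b q + y n) \<in> S"
    and l: "(\<forall>n. x n \<noteq> 0) \<and> x \<longlonglongrightarrow> 0 \<and> (\<exists>s. l = Some s \<and> (\<lambda>n. y n / x n) \<longlonglongrightarrow> s) \<or>
      l = None \<and> (\<forall>n. y n \<noteq> 0) \<and> y \<longlonglongrightarrow> 0 \<and> (\<lambda>n. x n / y n) \<longlonglongrightarrow> 0"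
  shows "Exc (\<psi> (a q) (b q)) l \<in> strict_transform F2 (fibre_points q L) S"
proof (rule Exc_in_strict_transform_sequence[where x = x and y = y])
  show "param_inv \<psi> (\<psi> u v) = vector [u, v]" for u v by (rule param_inv_curve[OF c])
  show "point_centre (\<psi>, a q, b q) \<in> fibre_points q L" using c by (force simp: fibre_points_def)
  show "\<And>d. d \<in> fibre_points q L \<Longrightarrow> \<psi> (a q) (b q) \<in> centre d \<Longrightarrow> d = point_centre (\<psi>, a q, b q)"
    using centre_fibre_unique[OF q c] .
  let ?Z = "centres (fibre_points q L)"
  \<comment> \<open>A null sequence with nonzero terms misses the value 0 by assumption and any
    other given value from some index on.\<close>
  have avoid: "\<forall>\<^sub>F n in sequentially. \<forall>p\<in>?Z. w n \<noteq> f p" if "\<forall>n. w n \<noteq> 0" "w \<longlonglongrightarrow> 0"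
    for w :: "nat \<Rightarrow> complex" and f
  proof (rule eventually_ball_finite[OF finite_centres_fibre[OF q]], rule ballI)
    fix p show "\<forall>\<^sub>F n in sequentially. w n \<noteq> f p"
      by (cases "f p = 0") (use that in \<open>auto intro: tendsto_imp_eventually_ne\<close>)
  qed
  have "\<forall>\<^sub>F n in sequentially. \<psi> (a q + x n) (b q + y n) \<notin> ?Z"
    using l
  proof
    assume "(\<forall>n. x n \<noteq> 0) \<and> x \<longlonglongrightarrow> 0 \<and> (\<exists>s. l = Some s \<and> (\<lambda>n. y n / x n) \<longlonglongrightarrow> s)"
    then have "\<forall>\<^sub>F n in sequentially. \<forall>p\<in>?Z. x n \<noteq> param_inv \<psi> p $ 1 - a q" by (intro avoid) auto
    then show ?thesis by eventually_elim (use param_inv_curve[OF c] in fastforce)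
  next
    assume "l = None \<and> (\<forall>n. y n \<noteq> 0) \<and> y \<longlonglongrightarrow> 0 \<and> (\<lambda>n. x n / y n) \<longlonglongrightarrow> 0"
    then have "\<forall>\<^sub>F n in sequentially. \<forall>p\<in>?Z. y n \<noteq> param_inv \<psi> p $ 2 - b q" by (intro avoid) auto
    then show ?thesis by eventually_elim (use param_inv_curve[OF c] in fastforce)
  qed
  then show "\<forall>\<^sub>F n in sequentially. \<psi> (a q + x n) (b q + y n) \<in> S - ?Z"
    using S by simp
next
  fix s assume "l = Some s"
  then show "(\<forall>\<^sub>F n in sequentially. x n \<noteq> 0) \<and> x \<longlonglongrightarrow> 0 \<and> (\<lambda>n. y n / x n) \<longlonglongrightarrow> s"
    using l by auto
next
  assume l0: "l \<noteq> Some 0"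
  show "(\<forall>\<^sub>F n in sequentially. y n \<noteq> 0) \<and> y \<longlonglongrightarrow> 0 \<and>
      (\<lambda>n. x n / y n) \<longlonglongrightarrow> (case l of None \<Rightarrow> 0 | Some s \<Rightarrow> 1 / s)"
  proof (cases l)
    case None
    then show ?thesis using l by auto
  next
    case (Some s)
    then have x: "\<And>n. x n \<noteq> 0" "x \<longlonglongrightarrow> 0" and s: "(\<lambda>n. y n / x n) \<longlonglongrightarrow> s" "s \<noteq> 0"
      using l l0 by auto
    have "\<forall>\<^sub>F n in sequentially. y n / x n \<noteq> 0" by (rule tendsto_imp_eventually_ne[OF s])
    then have ev: "\<forall>\<^sub>F n in sequentially. y n \<noteq> 0" by eventually_elim auto
    \<comment> \<open>y is recovered as (y/x) x, a product of a convergent and a null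
      sequence.\<close>
    have "(\<lambda>n. y n / x n * x n) \<longlonglongrightarrow> s * 0" by (rule tendsto_mult[OF s(1) x(2)])
    then have "y \<longlonglongrightarrow> 0" using x(1) by simp
    moreover have "(\<lambda>n. inverse (y n / x n)) \<longlonglongrightarrow> inverse s" by (rule tendsto_inverse[OF s])
    then have "(\<lambda>n. x n / y n) \<longlonglongrightarrow> 1 / s" by (simp add: inverse_eq_divide)
    ultimately show ?thesis using ev Some by simp
  qed
qed

end

section \<open>The discarded curves as sets of points\<close>

lemma mem_curve_H: "p \<in> curve_H \<longleftrightarrow> snd p = None"
proof
  assume "snd p = None"
  then obtain x where "p = (x, None)" by (cases p) auto
  then show "p \<in> curve_H"
    by (cases x) (auto simp: curve_H_def uv1_def uv3_def)
qed (auto simp: curve_H_def uv1_def uv3_def)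

lemma mem_curve_D: "p \<in> curve_D c \<longleftrightarrow> fst p = Some c"
proof
  assume "fst p = Some c"
  then obtain y where "p = (Some c, y)" by (cases p) auto
  then show "p \<in> curve_D c"
    by (cases y) (auto simp: curve_D_def uv_def uv1_def)
qed (auto simp: curve_D_def uv_def uv1_def)

lemma mem_curve_D_inf: "p \<in> curve_D_inf \<longleftrightarrow> fst p = None"
proof
  assume "fst p = None"
  then obtain y where "p = (None, y)" by (cases p) auto
  then show "p \<in> curve_D_inf"
    by (cases y) (auto simp: curve_D_inf_def uv2_def uv3_def)
qed (auto simp: curve_D_inf_def uv2_def uv3_def)

lemma uv_in_surface_C:
  assumes "q \<noteq> 0" "(u - 1) * (u - t) = (1 - q) * v" shows "(q, uv u v) \<in> surface_C t"
  unfolding surface_C_def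
  by (rule subsetD[OF closure_of_subset]) (use assms in \<open>auto simp: topspace_atlas points_times_atlas points_F2\<close>)

lemma uv_in_curve_Cq:
  assumes "(u - 1) * (u - t) = (1 - q) * v" shows "uv u v \<in> curve_Cq q t"
  unfolding curve_Cq_def
  by (rule subsetD[OF closure_of_subset]) (use assms in \<open>auto simp: topspace_atlas points_F2\<close>)

lemma hirz_cases:
  obtains "snd p = None" | "fst p = None" | u v where "p = uv u v"
proof -
  obtain x y where "p = (x, y)" by (cases p)
  then show thesis using that by (cases x; cases y) (auto simp: uv_def)
qed

lemma obtain_null_sequence: obtains h :: "nat \<Rightarrow> complex" where "\<And>n. h n \<noteq> 0" "h \<longlonglongrightarrow> 0"
proof
  show "(\<lambda>n. 1 / of_nat (Suc n) :: complex) \<longlonglongrightarrow> 0"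
    by (rule LIMSEQ_Suc[OF lim_1_over_n])
  show "1 / of_nat (Suc n) \<noteq> (0 :: complex)" for n by (simp del: of_nat_Suc)
qed

section \<open>Discarded normal directions and the two kinds of fibres\<close>

context marked_family
begin

abbreviation "D q \<equiv> fibre_points q L"

text \<open>The approximating sequence runs along the ruling itself, with x = 0 throughout.\<close>

lemma vertical_direction_removed:
  assumes "q \<in> B" "(\<psi>, a, b) \<in> L" "\<And>v. \<psi> (a q) v \<in> S"
  shows "Exc (\<psi> (a q) (b q)) None \<in> strict_transform F2 (D q) S"
proof -
  obtain h :: "nat \<Rightarrow> complex" where "\<And>n. h n \<noteq> 0" "h \<longlonglongrightarrow> 0" using obtain_null_sequence by blast
  then show ?thesis
    using assms by (intro Exc_in_fibre_strict_transform[where x = "\<lambda>n. 0" and y = h]) auto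
qed

lemma tangent_direction_removed:
  assumes q: "q \<in> B" "q \<noteq> 1" and c: "(uv, a, b) \<in> L"
    and C: "(a q - 1) * (a q - t) = (1 - q) * b q" and s: "(1 - q) * s = 2 * a q - 1 - t"
  shows "Exc (uv (a q) (b q)) (Some s) \<in> strict_transform F2 (D q) (curve_Cq q t)"
proof -
  obtain h :: "nat \<Rightarrow> complex" where h: "\<And>n. h n \<noteq> 0" "h \<longlonglongrightarrow> 0" using obtain_null_sequence by blast
  \<comment> \<open>Solving the equation of the curve at u = a + h for v - b gives h (2a - 1 - t +
    h) / (1 - q), which is this expression by the choice of s. Its quotient by h tends to s.\<close>
  define y where "y n = h n * (s + h n / (1 - q))" for n
  have "uv (a q + h n) (b q + y n) \<in> curve_Cq q t" for n
  proof (rule uv_in_curve_Cq)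
    have "(1 - q) * y n = h n * ((1 - q) * s + h n)"
      using q(2) by (simp add: y_def field_simps)
    also have "\<dots> = h n * (2 * a q - 1 - t + h n)" by (simp add: s)
    finally have "(1 - q) * (b q + y n) = (a q - 1) * (a q - t) + h n * (2 * a q - 1 - t + h n)"
      by (simp add: C distrib_left)
    then show "(a q + h n - 1) * (a q + h n - t) = (1 - q) * (b q + y n)" by algebra
  qed
  moreover have "(\<lambda>n. y n / h n) \<longlonglongrightarrow> s"
  proof -
    have "(\<lambda>n. s + h n / (1 - q)) \<longlonglongrightarrow> s + 0 / (1 - q)"
      using q(2) by (intro tendsto_intros h) simp
    then show ?thesis using h(1) by (simp add: y_def)
  qed
  ultimately show ?thesis
    using h q(1) c by (intro Exc_in_fibre_strict_transform[where x = h and y = y]) auto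
qed

lemma points_fibre_cases:
  assumes "q \<in> B" "z \<in> points (blowup F2 (D q))"
  obtains p where "z = Off p" "p \<notin> centres (D q)"
    | \<psi> a b l where "z = Exc (\<psi> (a q) (b q)) l" "(\<psi>, a, b) \<in> L"
  using assms(2) in_centres_fibre[OF assms(1)] unfolding points_blowup_fibre by fastforce

lemma not_kept_Exc_cases:
  assumes "q \<in> B" "(\<psi>, a, b) \<in> L" "\<not> kept t q (Exc (\<psi> (a q) (b q)) l)"
  obtains "\<psi> = uv" "a q = 0" "l = None" | "\<psi> = uv2" "a q = 0" "l = None"
    | "\<psi> = uv" "(a q - 1) * (a q - t) = (1 - q) * b q"
      "case l of None \<Rightarrow> q = 1 | Some s \<Rightarrow> (1 - q) * s = 2 * a q - 1 - t"
  using curve_cases[OF assms(2)]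
proof (elim disjE conjE)
  assume h: "\<psi> = uv" "\<forall>q\<in>B. a q = 0 \<and> t \<noteq> (1 - q) * b q"
  then show thesis using assms by (intro that(1)) (auto simp: kept_Exc_uv)
next
  assume h: "\<psi> = uv2" "\<forall>q\<in>B. a q = 0 \<and> 1 \<noteq> (1 - q) * b q"
  then show thesis using assms by (intro that(2)) (auto simp: kept_Exc_uv2)
next
  assume h: "\<psi> = uv" "\<forall>q\<in>B. a q \<noteq> 0 \<and> (a q - 1) * (a q - t) = (1 - q) * b q"
  then show thesis using assms by (intro that(3)) (auto simp: kept_Exc_uv split: option.splits)
qed

text \<open>At q = 1 the surface restricts in finite coordinates to the rulings over 1 and t, which
  accounts for the two extra strict transforms in place of that of a curve.\<close>

lemma fibre_is_undeformed:
  assumes one: "1 \<in> B" and t: "t \<noteq> 1"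
  shows "fibre_is (remove_closed X removed) 1
    (remove_closed (blowup F2 (D 1))
      (down -` curve_H \<union> strict_transform F2 (D 1) (curve_D 0) \<union> strict_transform F2 (D 1) (curve_D 1) \<union>
       strict_transform F2 (D 1) (curve_D t) \<union> strict_transform F2 (D 1) curve_D_inf))"
    (is "fibre_is _ _ (remove_closed _ ?R)")
proof (rule fibre_is_of_kept[OF one])
  fix z assume z: "z \<in> points (blowup F2 (D 1))" "\<not> kept t 1 z"
  from one z(1) show "z \<in> ?R"
  proof (cases rule: points_fibre_cases)
    case (1 p)
    have ST: "z \<in> strict_transform F2 (D 1) S" if "p \<in> S" for S
      unfolding 1(1) by (rule Off_in_strict_transform[OF that]) (use z(1) 1 in simp_all)
    show ?thesis
    proof (cases p rule: hirz_cases)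
      case (3 u v)
      then have "u = 0 \<or> u = 1 \<or> u = t" using z(2) 1 by (auto simp: kept_Off_uv)
      then show ?thesis using ST 3 by (auto simp: mem_curve_D uv_def)
    qed (use ST 1 in \<open>auto simp: mem_curve_H mem_curve_D_inf\<close>)
  next
    case (2 \<psi> a b l)
    note E = 2
    note vertical = vertical_direction_removed[OF one 2(2)]
    from one 2(2) z(2)[unfolded 2(1)] show ?thesis
    proof (cases rule: not_kept_Exc_cases)
      case 1
      then show ?thesis using vertical[of "curve_D 0"] E 1 by (simp add: mem_curve_D uv_def)
    next
      case 2
      then show ?thesis using vertical[of curve_D_inf] E 2 by (simp add: mem_curve_D_inf uv2_def)
    next
      case 3
      then have a: "a 1 = 1 \<or> a 1 = t" by auto
      \<comment> \<open>A finite direction would force 2a = 1 + t, hence t = 1 both for a = 1 and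
        for a = t.\<close>
      have "l = None" using 3(3) a t by (auto split: option.splits)
      then show ?thesis using vertical[of "curve_D (a 1)"] a E 3 by (auto simp: mem_curve_D uv_def)
    qed
  qed
next
  fix z assume z: "z \<in> points (blowup F2 (D 1))" "z \<in> ?R"
  have lift: "map_blown (Pair 1) z \<in> removed" if "z \<in> strict_transform F2 (D 1) S"
    "\<And>p. p \<in> S \<Longrightarrow> p \<in> curve_H \<or> p \<in> curve_D 0 \<or> p \<in> curve_D_inf \<or> (1, p) \<in> surface_C t" for S
    using strict_transform_fibre_removed[OF one _ that(1)] in_removed[OF one] that(2) by blast
  \<comment> \<open>The point of such a ruling at v = infinity belongs to \<open>curve_H\<close>; at
    the others the equation of the surface for q = 1 holds.\<close>
  have D: "p \<in> curve_H \<or> (1, p) \<in> surface_C t" if "p \<in> curve_D c" "c = 1 \<or> c = t" for p c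
  proof (cases p rule: hirz_cases)
    case (3 u v)
    then show ?thesis using that by (intro disjI2) (auto simp: mem_curve_D uv_def[of u v] intro!: uv_in_surface_C[unfolded uv_def])
  qed (use that in \<open>auto simp: mem_curve_H mem_curve_D\<close>)
  from one z(1) show "map_blown (Pair 1) z \<in> removed"
  proof (cases rule: points_fibre_cases)
    case (1 p)
    show ?thesis
    proof (cases "p \<in> curve_H")
      case True
      then show ?thesis using in_removed[OF one 1(2)] 1(1) by simp
    next
      case False
      then have "z \<notin> down -` curve_H" using 1(1) by simp
      then show ?thesis using z(2) lift D by blast
    qed
  next
    case (2 \<psi> a b l)
    \<comment> \<open>All centres have finite second coordinate, so the full preimage of
      \<open>curve_H\<close> contains no exceptional point.\<close>
    have "z \<notin> down -` curve_H"
      using 2(1) curve_cases[OF 2(2)] one by (auto simp: mem_curve_H uv_def uv2_def)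
    then show ?thesis using z(2) lift D by blast
  qed
qed

lemma fibre_is_deformed:
  assumes q: "q \<in> B" "q \<noteq> 0" "q \<noteq> 1"
  shows "fibre_is (remove_closed X removed) q
    (remove_closed (blowup F2 (D q))
      (strict_transform F2 (D q) curve_H \<union> strict_transform F2 (D q) (curve_D 0) \<union>
       strict_transform F2 (D q) curve_D_inf \<union> strict_transform F2 (D q) (curve_Cq q t)))"
    (is "fibre_is _ _ (remove_closed _ ?R)")
proof (rule fibre_is_of_kept[OF q(1)])
  fix z assume z: "z \<in> points (blowup F2 (D q))" "\<not> kept t q z"
  from q(1) z(1) show "z \<in> ?R"
  proof (cases rule: points_fibre_cases)
    case (1 p)
    have ST: "z \<in> strict_transform F2 (D q) S" if "p \<in> S" for S
      unfolding 1(1) by (rule Off_in_strict_transform[OF that]) (use z(1) 1 in simp_all)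
    show ?thesis
    proof (cases p rule: hirz_cases)
      case (3 u v)
      then have "u = 0 \<or> (u - 1) * (u - t) = (1 - q) * v" using z(2) 1 by (auto simp: kept_Off_uv)
      then have "p \<in> curve_D 0 \<or> p \<in> curve_Cq q t"
        using 3 uv_in_curve_Cq by (auto simp: mem_curve_D uv_def)
      then show ?thesis using ST by blast
    qed (use ST 1 in \<open>auto simp: mem_curve_H mem_curve_D_inf\<close>)
  next
    case (2 \<psi> a b l)
    note E = 2
    note vertical = vertical_direction_removed[OF q(1) 2(2)]
    from q(1) 2(2) z(2)[unfolded 2(1)] show ?thesis
    proof (cases rule: not_kept_Exc_cases)
      case 1
      then show ?thesis using vertical[of "curve_D 0"] E 1 by (simp add: mem_curve_D uv_def)
    next
      case 2
      then show ?thesis using vertical[of curve_D_inf] E 2 by (simp add: mem_curve_D_inf uv2_def)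
    next
      case 3
      then obtain s where "l = Some s" "(1 - q) * s = 2 * a q - 1 - t"
        using q(3) by (auto split: option.splits)
      then show ?thesis using tangent_direction_removed[OF q(1,3)] E 3 by auto
    qed
  qed
next
  fix z assume z: "z \<in> points (blowup F2 (D q))" "z \<in> ?R"
  have lift: "map_blown (Pair q) z \<in> removed" if "z \<in> strict_transform F2 (D q) S"
    "\<And>p. p \<in> S \<Longrightarrow> p \<in> curve_H \<or> p \<in> curve_D 0 \<or> p \<in> curve_D_inf \<or> (q, p) \<in> surface_C t" for S
    using strict_transform_fibre_removed[OF q(1) _ that(1)] in_removed[OF q(1)] that(2) by blast
  \<comment> \<open>Points of the closure outside the finite chart are absorbed by
    \<open>curve_H\<close> and \<open>curve_D_inf\<close>.\<close>
  have Cq: "p \<in> curve_H \<or> p \<in> curve_D_inf \<or> (q, p) \<in> surface_C t" if "p \<in> curve_Cq q t" for p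
  proof (cases p rule: hirz_cases)
    case (3 u v)
    then show ?thesis using that q(2) curve_Cq_uv uv_in_surface_C by blast
  qed (auto simp: mem_curve_H mem_curve_D_inf)
  show "map_blown (Pair q) z \<in> removed"
    using z(2) lift Cq by blast
qed

end


section \<open>The eight curves\<close>

lemma omega_curves_inj:
  assumes "q \<in> omega_base \<theta>0 \<theta>1 \<theta>t \<theta>inf t"
    and "(\<psi>, a, b) \<in> set (omega_curves \<theta>0 \<theta>1 \<theta>t \<theta>inf t)" "(\<psi>', a', b') \<in> set (omega_curves \<theta>0 \<theta>1 \<theta>t \<theta>inf t)"
    and "\<psi> (a q) (b q) = \<psi>' (a' q) (b' q)"
  shows "(\<psi>, a, b) = (\<psi>', a', b')"
proof -
  have "inj_on (\<lambda>(\<psi>, a, b). \<psi> (a q) (b q)) (set (omega_curves \<theta>0 \<theta>1 \<theta>t \<theta>inf t))"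
    using assms(1) by (simp add: omega_base_def distinct_map)
  from inj_onD[OF this, of "(\<psi>, a, b)" "(\<psi>', a', b')"] show ?thesis
    using assms(2-4) by simp
qed

lemma continuous_on_Theta [continuous_intros]: "continuous_on S (Theta \<theta>)"
  unfolding Theta_def[abs_def] by (intro continuous_intros) auto

lemma omega_curves_continuous:
  assumes "(\<psi>, a, b) \<in> set (omega_curves \<theta>0 \<theta>1 \<theta>t \<theta>inf t)"
    and "\<And>q. q \<in> S \<Longrightarrow> q \<noteq> 0 \<and> Theta \<theta>0 q \<noteq> 0 \<and> Theta \<theta>1 q \<noteq> 0 \<and> Theta \<theta>t q \<noteq> 0 \<and> Theta \<theta>inf q \<noteq> 0"
  shows "continuous_on S a" "continuous_on S b"
  using assms unfolding omega_curves_def by (auto intro!: continuous_intros)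

lemma omega_curves_charts:
  "(\<psi>, a, b) \<in> set (omega_curves \<theta>0 \<theta>1 \<theta>t \<theta>inf t) \<Longrightarrow> \<psi> \<in> {uv, uv2}"
  unfolding omega_curves_def by auto

text \<open>For degenerate parameters, such as \<theta>0 = 0, two entries of the list are the same
  curve and the base is empty. Otherwise it is the intersection of the finitely many conditions that
  two different entries take different values, each of which is open where the curves are
  defined.\<close>

lemma open_omega_base: "open (omega_base \<theta>0 \<theta>1 \<theta>t \<theta>inf t)"
proof (cases "distinct (omega_curves \<theta>0 \<theta>1 \<theta>t \<theta>inf t)")
  case False
  then have "omega_base \<theta>0 \<theta>1 \<theta>t \<theta>inf t = {}" by (auto simp: omega_base_def distinct_map)
  then show ?thesis by simp
next
  case True
  let ?L = "set (omega_curves \<theta>0 \<theta>1 \<theta>t \<theta>inf t)"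
  let ?P = "\<lambda>(\<psi>, a, b) q. (\<psi> :: complex \<Rightarrow> complex \<Rightarrow> hirz) (a q :: complex) (b q)"
  define S where "S = {q. q \<noteq> 0 \<and> Theta \<theta>0 q \<noteq> 0 \<and> Theta \<theta>1 q \<noteq> 0 \<and> Theta \<theta>t q \<noteq> 0 \<and> Theta \<theta>inf q \<noteq> 0}"
  have S: "open S" unfolding S_def
    by (intro open_Collect_conj open_Collect_neq continuous_intros)
  have "open (S \<inter> (\<Inter>(c, c')\<in>?L \<times> ?L - Id. {q \<in> S. ?P c q \<noteq> ?P c' q}))"
  proof (intro open_Int S open_INT ballI)
    show "finite (?L \<times> ?L - Id)" by simp
    fix x assume "x \<in> ?L \<times> ?L - Id"
    then obtain \<psi> a b \<psi>' a' b' where x: "x = ((\<psi>, a, b), (\<psi>', a', b'))" "(\<psi>, a, b) \<in> ?L" "(\<psi>', a', b') \<in> ?L"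
      by (cases x) auto
    show "open (case x of (c, c') \<Rightarrow> {q \<in> S. ?P c q \<noteq> ?P c' q})"
      unfolding x(1) prod.case
      by (intro open_separated S omega_curves_charts[OF x(2)] omega_curves_charts[OF x(3)]
          omega_curves_continuous[OF x(2)] omega_curves_continuous[OF x(3)]) (auto simp: S_def)
  qed
  moreover have "S \<inter> (\<Inter>(c, c')\<in>?L \<times> ?L - Id. {q \<in> S. ?P c q \<noteq> ?P c' q}) = {q \<in> S. inj_on (\<lambda>c. ?P c q) ?L}"
    unfolding inj_on_def by blast
  moreover have "{q \<in> S. inj_on (\<lambda>c. ?P c q) ?L} = omega_base \<theta>0 \<theta>1 \<theta>t \<theta>inf t"
  proof -
    have P: "(\<lambda>c. ?P c q) = (\<lambda>(\<psi>, a, b). \<psi> (a q) (b q))" for q by auto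
    show ?thesis unfolding P using True by (auto simp: omega_base_def S_def distinct_map)
  qed
  ultimately show ?thesis by simp
qed

text \<open>Everything follows from (1 - q) \<theta> / 2 = 1 - Theta, which makes (1 - q) v a
  rational expression in Theta. On the ruling over 0 it equals t - t / Theta or t - t Theta, and on
  the ruling over infinity 1 - 1 / Theta or 1 - Theta / q; none of these reaches the forbidden value
  t or 1, as Theta, t and q are nonzero. The four remaining curves satisfy the equation of the
  surface identically.\<close>

lemma omega_curve_cases:
  assumes t: "t \<noteq> 0" and c: "(\<psi>, a, b) \<in> set (omega_curves \<theta>0 \<theta>1 \<theta>t \<theta>inf t)"
  defines "B \<equiv> omega_base \<theta>0 \<theta>1 \<theta>t \<theta>inf t"
  shows "\<psi> = uv \<and> (\<forall>q\<in>B. a q = 0 \<and> t \<noteq> (1 - q) * b q) \<or>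
      \<psi> = uv2 \<and> (\<forall>q\<in>B. a q = 0 \<and> 1 \<noteq> (1 - q) * b q) \<or>
      \<psi> = uv \<and> (\<forall>q\<in>B. a q \<noteq> 0 \<and> (a q - 1) * (a q - t) = (1 - q) * b q)"
proof -
  have half: "(1 - q) * (\<theta> / 2) = 1 - Theta \<theta> q" for q \<theta> :: complex
    by (simp add: Theta_def field_simps)
  have 1: "(1 - q) * (- t * \<theta>0 / 2 / Theta \<theta>0 q) \<noteq> t" if "Theta \<theta>0 q \<noteq> 0" for q
  proof -
    have "(1 - q) * (- t * \<theta>0 / 2 / Theta \<theta>0 q) = - t * ((1 - q) * (\<theta>0 / 2)) / Theta \<theta>0 q" by simp
    also have "\<dots> = t - t / Theta \<theta>0 q" unfolding half using that by (simp add: field_simps)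
    finally show ?thesis using t that by simp
  qed
  have 2: "(1 - q) * (t * \<theta>0 / 2) \<noteq> t" if "Theta \<theta>0 q \<noteq> 0" for q
  proof -
    have "(1 - q) * (t * \<theta>0 / 2) = t * ((1 - q) * (\<theta>0 / 2))" by simp
    also have "\<dots> = t - t * Theta \<theta>0 q" unfolding half by (simp add: field_simps)
    finally show ?thesis using t that by simp
  qed
  have 3: "(1 / Theta \<theta>1 q - 1) * (1 / Theta \<theta>1 q - t) =
      (1 - q) * ((- (\<theta>1 / 2) * (t - 1 / Theta \<theta>1 q)) / Theta \<theta>1 q)" if "Theta \<theta>1 q \<noteq> 0" for q
  proof -
    have "(1 - q) * ((- (\<theta>1 / 2) * (t - 1 / Theta \<theta>1 q)) / Theta \<theta>1 q) =
      - ((1 - q) * (\<theta>1 / 2)) * (t - 1 / Theta \<theta>1 q) / Theta \<theta>1 q" by simp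
    also have "\<dots> = (1 / Theta \<theta>1 q - 1) * (1 / Theta \<theta>1 q - t)"
      unfolding half using that by (simp add: divide_simps) algebra
    finally show ?thesis by simp
  qed
  have 4: "(Theta \<theta>1 q - 1) * (Theta \<theta>1 q - t) = (1 - q) * (\<theta>1 * (t - Theta \<theta>1 q) / 2)" for q
  proof -
    have "(1 - q) * (\<theta>1 * (t - Theta \<theta>1 q) / 2) = ((1 - q) * (\<theta>1 / 2)) * (t - Theta \<theta>1 q)" by simp
    then show ?thesis unfolding half by algebra
  qed
  have 5: "(t * Theta \<theta>t q - 1) * (t * Theta \<theta>t q - t) = (1 - q) * (- (t * \<theta>t / 2) * (t * Theta \<theta>t q - 1))" for q
  proof -
    have "(1 - q) * (- (t * \<theta>t / 2) * (t * Theta \<theta>t q - 1)) = - t * ((1 - q) * (\<theta>t / 2)) * (t * Theta \<theta>t q - 1)" by simp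
    then show ?thesis unfolding half by algebra
  qed
  have 6: "(t / Theta \<theta>t q - 1) * (t / Theta \<theta>t q - t) =
      (1 - q) * ((t * (t - Theta \<theta>t q) * \<theta>t / 2) / (Theta \<theta>t q)\<^sup>2)" if "Theta \<theta>t q \<noteq> 0" for q
  proof -
    have "(1 - q) * ((t * (t - Theta \<theta>t q) * \<theta>t / 2) / (Theta \<theta>t q)\<^sup>2) =
      t * (t - Theta \<theta>t q) * ((1 - q) * (\<theta>t / 2)) / (Theta \<theta>t q)\<^sup>2" by simp
    then show ?thesis unfolding half using that by (simp add: divide_simps) algebra
  qed
  have 7: "(1 - q) * ((- \<theta>inf / 2) / Theta \<theta>inf q) \<noteq> 1" if "Theta \<theta>inf q \<noteq> 0" for q
  proof -
    have "(1 - q) * ((- \<theta>inf / 2) / Theta \<theta>inf q) = - ((1 - q) * (\<theta>inf / 2)) / Theta \<theta>inf q" by simp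
    then show ?thesis unfolding half using that by (simp add: divide_simps)
  qed
  have 8: "(1 - q) * ((\<theta>inf / 2 - 1) / q) \<noteq> 1" if "Theta \<theta>inf q \<noteq> 0" "q \<noteq> 0" for q
  proof -
    have "(1 - q) * ((\<theta>inf / 2 - 1) / q) = ((1 - q) * (\<theta>inf / 2) - (1 - q)) / q" by (simp add: right_diff_distrib)
    then show ?thesis unfolding half using that by (simp add: divide_simps)
  qed
  have B: "q \<in> B \<Longrightarrow> q \<noteq> 0 \<and> Theta \<theta>0 q \<noteq> 0 \<and> Theta \<theta>1 q \<noteq> 0 \<and> Theta \<theta>t q \<noteq> 0 \<and> Theta \<theta>inf q \<noteq> 0" for q
    by (simp add: B_def omega_base_def)
  let ?P = "\<lambda>\<psi> a b. \<psi> = uv \<and> (\<forall>q\<in>B. a q = 0 \<and> t \<noteq> (1 - q) * b q) \<or>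
      \<psi> = uv2 \<and> (\<forall>q\<in>B. a q = 0 \<and> 1 \<noteq> (1 - q) * b q) \<or>
      \<psi> = uv \<and> (\<forall>q\<in>B. a q \<noteq> 0 \<and> (a q - 1) * (a q - t) = (1 - q) * b q)"
  \<comment> \<open>Stated entry by entry, so that each curve is matched with its own
    identity.\<close>
  have "list_all (\<lambda>(\<psi>, a, b). ?P \<psi> a b) (omega_curves \<theta>0 \<theta>1 \<theta>t \<theta>inf t)"
    unfolding omega_curves_def list.pred_inject prod.case
  proof (intro conjI TrueI)
    show "?P uv (\<lambda>q. 0) (\<lambda>q. (- t * \<theta>0 / 2) / Theta \<theta>0 q)"
      using B not_sym[OF 1] by blast
    show "?P uv (\<lambda>q. 0) (\<lambda>q. t * \<theta>0 / 2)"
      using B not_sym[OF 2] by blast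
    show "?P uv (\<lambda>q. 1 / Theta \<theta>1 q) (\<lambda>q. (- (\<theta>1 / 2) * (t - 1 / Theta \<theta>1 q)) / Theta \<theta>1 q)"
      using B 3 by (intro disjI2) simp
    show "?P uv (\<lambda>q. Theta \<theta>1 q) (\<lambda>q. \<theta>1 * (t - Theta \<theta>1 q) / 2)"
      using B 4 by blast
    show "?P uv (\<lambda>q. t * Theta \<theta>t q) (\<lambda>q. - (t * \<theta>t / 2) * (t * Theta \<theta>t q - 1))"
      using B 5 t by (intro disjI2) simp
    show "?P uv (\<lambda>q. t / Theta \<theta>t q) (\<lambda>q. (t * (t - Theta \<theta>t q) * \<theta>t / 2) / (Theta \<theta>t q)\<^sup>2)"
      using B 6 t by (intro disjI2) simp
    show "?P uv2 (\<lambda>q. 0) (\<lambda>q. (- \<theta>inf / 2) / Theta \<theta>inf q)"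
      using B not_sym[OF 7] by blast
    show "?P uv2 (\<lambda>q. 0) (\<lambda>q. (\<theta>inf / 2 - 1) / q)"
      using B not_sym[OF 8] by blast
  qed simp
  then show ?thesis using c unfolding list_all_iff by blast
qed

lemma marked_family_omega:
  assumes "t \<noteq> 0"
  shows "marked_family (omega_base \<theta>0 \<theta>1 \<theta>t \<theta>inf t) t (set (omega_curves \<theta>0 \<theta>1 \<theta>t \<theta>inf t))"
proof
  fix \<psi> a b assume c: "(\<psi>, a, b) \<in> set (omega_curves \<theta>0 \<theta>1 \<theta>t \<theta>inf t)"
  show "continuous_on (omega_base \<theta>0 \<theta>1 \<theta>t \<theta>inf t) a" "continuous_on (omega_base \<theta>0 \<theta>1 \<theta>t \<theta>inf t) b"
    by (rule omega_curves_continuous[OF c]; simp add: omega_base_def)+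
qed (use open_omega_base omega_curve_cases[OF assms] omega_curves_inj in simp_all)

section \<open>Specialising the eight curves at a value of q\<close>

lemma Theta_one [simp]: "Theta \<theta> 1 = 1"
  by (simp add: Theta_def)

lemma fibre_points_eq:
  "fibre_points q L = point_centre ` (\<lambda>(\<psi>, a, b). (\<psi>, a q, b q)) ` L"
  by (simp add: fibre_points_def image_image split_beta)

lemma fibre_points_undeformed:
  "fibre_points 1 (set (omega_curves \<theta>0 \<theta>1 \<theta>t \<theta>inf t)) = point_centre ` set (oka_points \<theta>0 \<theta>1 \<theta>t \<theta>inf t)"
proof -
  have "map (\<lambda>(\<psi>, a, b). (\<psi>, a 1, b 1)) (omega_curves \<theta>0 \<theta>1 \<theta>t \<theta>inf t) =
    [(uv, 0, - (t * \<theta>0 / 2)), (uv, 0, t * \<theta>0 / 2),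
     (uv, 1, - ((t - 1) * \<theta>1 / 2)), (uv, 1, (t - 1) * \<theta>1 / 2),
     (uv, t, - (t * (t - 1) * \<theta>t / 2)), (uv, t, t * (t - 1) * \<theta>t / 2),
     (uv2, 0, - (\<theta>inf / 2)), (uv2, 0, (\<theta>inf - 2) / 2)]"
    by (simp add: omega_curves_def diff_divide_distrib algebra_simps)
  then have "(\<lambda>(\<psi>, a, b). (\<psi>, a 1, b 1)) ` set (omega_curves \<theta>0 \<theta>1 \<theta>t \<theta>inf t) =
    set (oka_points \<theta>0 \<theta>1 \<theta>t \<theta>inf t)"
    \<comment> \<open>The two members of each pair come in opposite order in the two lists, so they
      are compared as sets.\<close>
    unfolding set_map[symmetric] oka_points_def by (simp only: list.set insert_commute)
  then show ?thesis by (simp add: fibre_points_eq)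
qed

text \<open>Away from q = 1 the relation \<theta> / 2 = (Theta - 1) / (q - 1) can be substituted; it
  is what makes the quotients by q - 1 extend over q = 1 as the curves of the family.\<close>

lemma fibre_points_deformed:
  assumes "q \<noteq> 0" "q \<noteq> 1" "Theta \<theta>0 q \<noteq> 0" "Theta \<theta>1 q \<noteq> 0" "Theta \<theta>t q \<noteq> 0" "Theta \<theta>inf q \<noteq> 0"
  shows "fibre_points q (set (omega_curves \<theta>0 \<theta>1 \<theta>t \<theta>inf t)) =
    point_centre ` set (qoka_points q (Theta \<theta>0 q) (Theta \<theta>1 q) (Theta \<theta>t q) (Theta \<theta>inf q) t)"
proof -
  have half: "\<theta> / 2 = (Theta \<theta> q - 1) / (q - 1)" for \<theta>
    using assms(2) by (simp add: Theta_def field_simps)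
  \<comment> \<open>A free \<open>x\<close> replaces the value of Theta, so that the eight equations
    are identities between rational functions and Theta is never unfolded in them.\<close>
  have half_eqs:
    "(- t * \<theta> / 2) / x = t * (1 / x - 1) / (q - 1)"
    "t * \<theta> / 2 = t * (x - 1) / (q - 1)"
    "(- (\<theta> / 2) * (t - 1 / x)) / x = (1 / x - 1) * (t - 1 / x) / (q - 1)"
    "\<theta> * (t - x) / 2 = (x - 1) * (t - x) / (q - 1)"
    "- (t * \<theta> / 2) * (t * x - 1) = - (t * (x - 1) * (t * x - 1) / (q - 1))"
    "(t * (t - x) * \<theta> / 2) / x\<^sup>2 = - (t * (1 / x - 1) * (t * (1 / x) - 1) / (q - 1))"
    "(- \<theta> / 2) / x = (1 / x - 1) / (q - 1)"
    "(\<theta> / 2 - 1) / q = (x - q) / (q * (q - 1))"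
    if "x \<noteq> 0" "\<theta> / 2 = (x - 1) / (q - 1)" for x \<theta>
  proof -
    have \<theta>: "\<theta> = 2 * (x - 1) / (q - 1)" using that(2) by simp
    have q: "q \<noteq> 0" "q - 1 \<noteq> 0" using assms by auto
    show "(- t * \<theta> / 2) / x = t * (1 / x - 1) / (q - 1)"
      "t * \<theta> / 2 = t * (x - 1) / (q - 1)"
      "(- (\<theta> / 2) * (t - 1 / x)) / x = (1 / x - 1) * (t - 1 / x) / (q - 1)"
      "\<theta> * (t - x) / 2 = (x - 1) * (t - x) / (q - 1)"
      "- (t * \<theta> / 2) * (t * x - 1) = - (t * (x - 1) * (t * x - 1) / (q - 1))"
      "(t * (t - x) * \<theta> / 2) / x\<^sup>2 = - (t * (1 / x - 1) * (t * (1 / x) - 1) / (q - 1))"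
      "(- \<theta> / 2) / x = (1 / x - 1) / (q - 1)"
      "(\<theta> / 2 - 1) / q = (x - q) / (q * (q - 1))"
      using q that(1) unfolding \<theta> by (simp add: divide_simps power2_eq_square, algebra?)+
  qed
  note eqs = half_eqs(1,2)[OF assms(3) half] half_eqs(3,4)[OF assms(4) half]
    half_eqs(5,6)[OF assms(5) half] half_eqs(7,8)[OF assms(6) half]
  have "map (\<lambda>(\<psi>, a, b). (\<psi>, a q, b q)) (omega_curves \<theta>0 \<theta>1 \<theta>t \<theta>inf t) =
    qoka_points q (Theta \<theta>0 q) (Theta \<theta>1 q) (Theta \<theta>t q) (Theta \<theta>inf q) t"
    unfolding omega_curves_def qoka_points_def list.map prod.case eqs by simp
  then have "(\<lambda>(\<psi>, a, b). (\<psi>, a q, b q)) ` set (omega_curves \<theta>0 \<theta>1 \<theta>t \<theta>inf t) =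
    set (qoka_points q (Theta \<theta>0 q) (Theta \<theta>1 q) (Theta \<theta>t q) (Theta \<theta>inf q) t)"
    unfolding set_map[symmetric] by simp
  then show ?thesis by (simp add: fibre_points_eq)
qed

text \<open>The u-coordinates separate the curves except within the pair over 0 and the pair over
  infinity. Non-resonance keeps the curves of index 1 apart from those of index t, and the
  conditions on squares separate the members of each of these two pairs. Within the two pairs
  sharing a ruling the second coordinates are compared.\<close>

lemma in_omega_base:
  assumes \<theta>: "\<theta>0 \<noteq> 0" "\<theta>1 \<noteq> 0" "\<theta>t \<noteq> 0" "\<theta>inf \<noteq> 1" and "t \<noteq> 0" "q \<noteq> 0" "q \<noteq> 1"
    and \<Theta>: "Theta \<theta>0 q \<noteq> 0" "Theta \<theta>1 q \<noteq> 0" "Theta \<theta>t q \<noteq> 0" "Theta \<theta>inf q \<noteq> 0"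
    and sq: "(Theta \<theta>0 q)\<^sup>2 \<noteq> 1" "(Theta \<theta>1 q)\<^sup>2 \<noteq> 1" "(Theta \<theta>t q)\<^sup>2 \<noteq> 1" "(Theta \<theta>inf q)\<^sup>2 \<noteq> q"
    and S: "t \<notin> S_set q (Theta \<theta>0 q) (Theta \<theta>1 q) (Theta \<theta>t q) (Theta \<theta>inf q)"
  shows "q \<in> omega_base \<theta>0 \<theta>1 \<theta>t \<theta>inf t"
proof -
  let ?A = "Theta \<theta>0 q" and ?B = "Theta \<theta>1 q" and ?T = "Theta \<theta>t q" and ?I = "Theta \<theta>inf q"
  have in_S: "?B powi e1 * ?T powi et \<in> S_set q ?A ?B ?T ?I" if "e1 \<in> {-1, 1}" "et \<in> {-1, 1}" for e1 et
  proof -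
    \<comment> \<open>The exponent 0 of q brings the bare products into the resonance set.\<close>
    have "?B powi e1 * ?T powi et = ?B powi e1 * ?T powi et * q powi 0" by simp
    then show ?thesis unfolding S_set_def using that by blast
  qed
  have resonance: "?B \<noteq> t * ?T" "?B \<noteq> t / ?T" "1 / ?B \<noteq> t * ?T" "1 / ?B \<noteq> t / ?T"
  proof -
    have "t \<noteq> ?B * ?T" "t \<noteq> ?B * inverse ?T" "t \<noteq> inverse ?B * ?T" "t \<noteq> inverse ?B * inverse ?T"
      using S in_S[of 1 1] in_S[of 1 "-1"] in_S[of "-1" 1] in_S[of "-1" "-1"]
      by (auto simp: power_int_minus)
    then show "?B \<noteq> t * ?T" "?B \<noteq> t / ?T" "1 / ?B \<noteq> t * ?T" "1 / ?B \<noteq> t / ?T"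
      using \<Theta> by (auto simp: field_simps)
  qed
  have "?A * ?A \<noteq> 1" "?B * ?B \<noteq> 1" "?T * ?T \<noteq> 1" "?I * ?I \<noteq> q"
    using sq by (simp_all add: power2_eq_square)
  then have distinct: "1 / ?A \<noteq> ?A" "1 / ?B \<noteq> ?B" "t * ?T \<noteq> t / ?T" "q / ?I \<noteq> ?I"
    using \<Theta> assms(5) by (auto simp: field_simps)
  have half: "(q - 1) * (\<theta> / 2) = Theta \<theta> q - 1" for \<theta>
    by (simp add: Theta_def)
  \<comment> \<open>As t and \<theta>0 are nonzero, equality would give Theta = -1, whose square is
    1.\<close>
  have 0: "- t * \<theta>0 / 2 / ?A \<noteq> t * \<theta>0 / 2"
  proof
    assume "- t * \<theta>0 / 2 / ?A = t * \<theta>0 / 2"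
    then have "- (t * \<theta>0) = t * \<theta>0 * ?A" using \<Theta>(1) by (simp add: divide_simps)
    then have "t * \<theta>0 * (?A + 1) = 0" by algebra
    then have "?A = -1" using \<theta>(1) assms(5) by (simp add: eq_neg_iff_add_eq_0)
    then show False using sq(1) by simp
  qed
  have inf: "- \<theta>inf / 2 / ?I \<noteq> (\<theta>inf / 2 - 1) / q"
  proof
    assume "- \<theta>inf / 2 / ?I = (\<theta>inf / 2 - 1) / q"
    then have "- \<theta>inf / 2 * q = (\<theta>inf / 2 - 1) * ?I"
      by (simp only: frac_eq_eq[OF \<Theta>(4) assms(6)])
    \<comment> \<open>Multiplication by q - 1 turns \<theta>inf / 2 into Theta - 1. The relation
      becomes -(Theta - 1) q = (Theta - q) Theta, that is, Theta squared equals q.\<close>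
    then have "- ((q - 1) * (\<theta>inf / 2)) * q = ((q - 1) * (\<theta>inf / 2) - (q - 1)) * ?I"
      by (simp add: left_diff_distrib right_diff_distrib mult.assoc) algebra
    then have "(?I)\<^sup>2 = q" unfolding half by algebra
    then show False using sq(4) by simp
  qed
  show ?thesis
    using \<Theta> assms(5,6) resonance distinct 0 inf
    by (simp add: omega_base_def omega_curves_def uv_eq_iff uv2_eq_iff uv_eq_uv2_iff)
qed

text \<open>At q = 1 the members of each finite pair have opposite second coordinates, nonzero by
  the assumptions on \<theta>0, \<theta>1, \<theta>t and t. At infinity the values are -\<theta>inf
  / 2 and \<theta>inf / 2 - 1, which collide exactly for \<theta>inf = 1.\<close>

lemma one_in_omega_base:
  assumes "\<theta>0 \<noteq> 0" "\<theta>1 \<noteq> 0" "\<theta>t \<noteq> 0" "\<theta>inf \<noteq> 1" "t \<noteq> 0" "t \<noteq> 1"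
  shows "1 \<in> omega_base \<theta>0 \<theta>1 \<theta>t \<theta>inf t"
  using assms by (simp add: omega_base_def omega_curves_def uv_eq_iff uv2_eq_iff uv_eq_uv2_iff)

theorem mainTheorem3:
  fixes \<theta>0 \<theta>1 \<theta>t \<theta>inf :: complex
  assumes "\<theta>0 \<noteq> 0" and "\<theta>1 \<noteq> 0" and "\<theta>t \<noteq> 0" and "\<theta>inf \<noteq> 1"
  shows "(\<forall>t. t \<noteq> 0 \<and> t \<noteq> 1 \<longrightarrow>
            fibre_is (Omega \<theta>0 \<theta>1 \<theta>t \<theta>inf t) 1 (Oka \<theta>0 \<theta>1 \<theta>t \<theta>inf t)) \<and>
         (\<forall>t q0. t \<noteq> 0 \<and> q0 \<noteq> 0 \<and> q0 \<noteq> 1 \<and>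
            Theta \<theta>0 q0 \<noteq> 0 \<and> Theta \<theta>1 q0 \<noteq> 0 \<and> Theta \<theta>t q0 \<noteq> 0 \<and> Theta \<theta>inf q0 \<noteq> 0 \<and>
            (Theta \<theta>0 q0)\<^sup>2 \<noteq> 1 \<and> (Theta \<theta>1 q0)\<^sup>2 \<noteq> 1 \<and> (Theta \<theta>t q0)\<^sup>2 \<noteq> 1 \<and>
            (Theta \<theta>inf q0)\<^sup>2 \<noteq> q0 \<and>
            t \<notin> S_set q0 (Theta \<theta>0 q0) (Theta \<theta>1 q0) (Theta \<theta>t q0) (Theta \<theta>inf q0) \<longrightarrow>
            fibre_is (Omega \<theta>0 \<theta>1 \<theta>t \<theta>inf t) q0
              (qOka q0 (Theta \<theta>0 q0) (Theta \<theta>1 q0) (Theta \<theta>t q0) (Theta \<theta>inf q0) t))"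
proof (intro conjI allI impI; elim conjE)
  fix t :: complex assume t: "t \<noteq> 0" "t \<noteq> 1"
  interpret marked_family "omega_base \<theta>0 \<theta>1 \<theta>t \<theta>inf t" t "set (omega_curves \<theta>0 \<theta>1 \<theta>t \<theta>inf t)"
    by (rule marked_family_omega[OF t(1)])
  show "fibre_is (Omega \<theta>0 \<theta>1 \<theta>t \<theta>inf t) 1 (Oka \<theta>0 \<theta>1 \<theta>t \<theta>inf t)"
    using fibre_is_undeformed[OF one_in_omega_base[OF assms t] t(2)]
    unfolding Omega_def Oka_def Let_def removed_def fibre_points_undeformed .
next
  fix t q :: complex
  assume t: "t \<noteq> 0" and q: "q \<noteq> 0" "q \<noteq> 1"
    and \<Theta>: "Theta \<theta>0 q \<noteq> 0" "Theta \<theta>1 q \<noteq> 0" "Theta \<theta>t q \<noteq> 0" "Theta \<theta>inf q \<noteq> 0"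
    and generic: "(Theta \<theta>0 q)\<^sup>2 \<noteq> 1" "(Theta \<theta>1 q)\<^sup>2 \<noteq> 1" "(Theta \<theta>t q)\<^sup>2 \<noteq> 1" "(Theta \<theta>inf q)\<^sup>2 \<noteq> q"
      "t \<notin> S_set q (Theta \<theta>0 q) (Theta \<theta>1 q) (Theta \<theta>t q) (Theta \<theta>inf q)"
  interpret marked_family "omega_base \<theta>0 \<theta>1 \<theta>t \<theta>inf t" t "set (omega_curves \<theta>0 \<theta>1 \<theta>t \<theta>inf t)"
    by (rule marked_family_omega[OF t])
  show "fibre_is (Omega \<theta>0 \<theta>1 \<theta>t \<theta>inf t) q
    (qOka q (Theta \<theta>0 q) (Theta \<theta>1 q) (Theta \<theta>t q) (Theta \<theta>inf q) t)"
    using fibre_is_deformed[OF in_omega_base[OF assms t q \<Theta> generic] q]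
    unfolding Omega_def qOka_def Let_def removed_def fibre_points_deformed[OF q \<Theta>] .
qed

end
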